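(* Let $\xi:[0,1]\to\mathcal{O}_{L_0}$ be a geodesic of the Riemannian (Levi-Civita) connection induced by the ambient metric $\mathcal{A}$ on $\mathcal{O}_{L_0}$, with initial position $\xi(0)=L$ and initial velocity $\dot\xi(0)=w\in T_L\mathcal{O}_{L_0}=\mathcal{B}_2(L)_s$. Then there is $v\in\mathfrak{sp}_2(\mathcal{H})$ with $d_1\pi_L(v)=-w$ such that $$\xi(t)=e^{t(v^*-v)}e^{-tv^*}(L)\qquad\text{for all } t\in[0,1].$$
   Context: Let $\mathcal{H}$ be an infinite-dimensional real Hilbert space, $\mathcal{B}(\mathcal{H})$ its bounded operators, $\mathcal{B}_2(\mathcal{H})$ the Hilbert–Schmidt operators with $\|a\|_2=\mathrm{Tr}(a^*a)^{1/2}$. For a closed subspace $W$, $\mathcal{B}(W)_s$ (resp. $\mathcal{B}_2(W)_s$) denotes the symmetric bounded (resp. symmetric Hilbert–Schmidt) operators on $W$, and $P_W$ the orthogonal projection onto $W$. Fix $J\in\mathcal{B}(\mathcal{H})$, a linear isometry with $J^2=-1$, $J^*=-J$. Let $\mathrm{Sp}(\mathcal{H})=\{g \text{ invertible in }\mathcal{B}(\mathcal{H}): g^*Jg=J\}$ and $\mathrm{Sp}_2(\mathcal{H})=\{g\in \mathrm{Sp}(\mathcal{H}): g-1\in\mathcal{B}_2(\mathcal{H})\}$, a Banach–Lie group with topology induced by $\|g_1-g_2\|_2$ and Lie algebra $\mathfrak{sp}_2(\mathcal{H})=\{x\in\mathcal{B}_2(\mathcal{H}): xJ=-Jx^*\}$.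 The Lagrangian Grassmannian $\Lambda(\mathcal{H})$ is the set of closed subspaces $L\subset\mathcal{H}$ with $J(L)=L^\perp$. Fix $L_0\in\Lambda(\mathcal{H})$ and put $\mathcal{O}_{L_0}=\{g(L_0): g\in \mathrm{Sp}_2(\mathcal{H})\}$. Manifold structure: for $L\in\Lambda(\mathcal{H})$ let $\Omega(L^\perp)=\{W\in\Lambda(\mathcal{H}): \mathcal{H}=W\oplus L^\perp\}$. Each $W\in\Omega(L^\perp)$ is the graph $\{v+Tv: v\in L\}$ of a unique bounded $T:L\to L^\perp$, and $\phi_L(W):=J|_{L^\perp}T\in\mathcal{B}(L)_s$. For $L\in\mathcal{O}_{L_0}$, $\phi_L$ restricts to a bijection $\Omega(L^\perp)\cap\mathcal{O}_{L_0}\to\mathcal{B}_2(L)_s$; these restrictions are the charts giving $\mathcal{O}_{L_0}$ its topology and smooth Hilbert manifold structure. The tangent space $T_W\mathcal{O}_{L_0}$ is identified with $\mathcal{B}_2(W)_s$ through the differential at $W$ of the chart $\phi_W$. For $L\in\mathcal{O}_{L_0}$, $\pi_L:\mathrm{Sp}_2(\mathcal{H})\to\mathcal{O}_{L_0}$ is $\pi_L(g)=g(L)$; its differential at $1$ is $d_1\pi_L(x)=P_LJx|_L\in\mathcal{B}_2(L)_s$ for $x\in\mathfrak{sp}_2(\mathcal{H})$. The ambient metric is the Riemannian metric on $\mathcal{O}_{L_0}$ given by $\langle v,u\rangle_W=\mathrm{tr}_W(u^*v)$ for $v,u\in T_W\mathcal{O}_{L_0}=\mathcal{B}_2(W)_s$,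 with norm $\mathcal{A}(W,v)=\mathrm{tr}_W(v^*v)^{1/2}$. *)

theory Defs
  imports "HOL-Analysis.Analysis"
begin

section \<open>Bounded operators on a real Hilbert space\<close>

text \<open>A real Hilbert space is a type of sort \<open>{real_inner, banach}\<close>. The library proves the existence
  of adjoints, projections and orthonormal bases for Euclidean spaces only, so they are established
  here for Hilbert spaces.\<close>

definition adj :: "('a::{real_inner,banach} \<Rightarrow>\<^sub>L 'a) \<Rightarrow> ('a \<Rightarrow>\<^sub>L 'a)" where
  "adj A = Blinfun (adjoint (blinfun_apply A))"

definition proj :: "'a::{real_inner,banach} set \<Rightarrow> ('a \<Rightarrow>\<^sub>L 'a)" where
  "proj W = (THE P :: 'a \<Rightarrow>\<^sub>L 'a. \<forall>x. P x \<in> W \<and> x - P x \<in> W\<^sup>\<bottom>)"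

definition bexp :: "('a::{real_inner,banach} \<Rightarrow>\<^sub>L 'a) \<Rightarrow> ('a \<Rightarrow>\<^sub>L 'a)" where
  "bexp A = (\<Sum>n. (1 / fact n) *\<^sub>R (((\<lambda>B. A o\<^sub>L B) ^^ n) id_blinfun))"

definition is_onb :: "'a::{real_inner,banach} set \<Rightarrow> 'a set \<Rightarrow> bool" where
  "is_onb W E \<longleftrightarrow> E \<subseteq> W \<and> pairwise orthogonal E \<and> (\<forall>e\<in>E. norm e = 1) \<and> closure (span E) = W"

definition some_onb :: "'a::{real_inner,banach} set \<Rightarrow> 'a set" where
  "some_onb W = (SOME E. is_onb W E)"

text \<open>The trace over a closed subspace \<open>W\<close>; for the trace class operators to which it is applied the
  value does not depend on the basis. The same holds for the Hilbert--Schmidt property, which says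
  that \<open>adj a o\<^sub>L a\<close> has finite trace.\<close>

definition tr_on :: "'a::{real_inner,banach} set \<Rightarrow> ('a \<Rightarrow>\<^sub>L 'a) \<Rightarrow> real" where
  "tr_on W A = (\<Sum>\<^sub>\<infinity>e\<in>some_onb W. A e \<bullet> e)"

definition hilbert_schmidt :: "('a::{real_inner,banach} \<Rightarrow>\<^sub>L 'a) \<Rightarrow> bool" where
  "hilbert_schmidt A \<longleftrightarrow> (\<lambda>e. (adj A o\<^sub>L A) e \<bullet> e) summable_on some_onb UNIV"

lemma projection_exists:
  fixes W :: "'a::{real_inner,banach} set"
  assumes W: "subspace W" "closed W"
  shows "\<exists>p\<in>W. \<forall>y\<in>W. (x - p) \<bullet> y = 0"
proof -
  let ?S = "(\<lambda>y. (norm (x - y))\<^sup>2) ` W"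
  define d where "d = Inf ?S"
  have ne: "?S \<noteq> {}" using subspace_0[OF W(1)] by auto
  have bd: "bdd_below ?S" by (rule bdd_belowI[of _ 0]) auto
  have dle: "d \<le> (norm (x - y))\<^sup>2" if "y \<in> W" for y
    unfolding d_def using cInf_lower[OF imageI bd] that by blast
  have "\<exists>y\<in>W. (norm (x - y))\<^sup>2 < d + 1 / Suc n" for n
  proof -
    have "Inf ?S < d + 1 / Suc n" by (simp add: d_def)
    then show ?thesis using cInf_lessD[OF ne] by blast
  qed
  then obtain y where yW: "\<And>n. y n \<in> W" and yd: "\<And>n. (norm (x - y n))\<^sup>2 < d + 1 / Suc n"
    by metis
  have par: "(norm (y m - y n))\<^sup>2 \<le> 2 / Suc m + 2 / Suc n" for m n
  proof -
    have "(1/2) *\<^sub>R (y m + y n) \<in> W" using yW W(1) by (simp add: subspace_add subspace_scale)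
    then have 1: "d \<le> (norm (x - (1/2) *\<^sub>R (y m + y n)))\<^sup>2" by (rule dle)
    have "(norm (y m - y n))\<^sup>2
        = 2 * (norm (x - y m))\<^sup>2 + 2 * (norm (x - y n))\<^sup>2 - 4 * (norm (x - (1/2) *\<^sub>R (y m + y n)))\<^sup>2"
      by (simp add: power2_norm_eq_inner algebra_simps inner_commute)
    also have "\<dots> \<le> 2 / Suc m + 2 / Suc n"
      using 1 yd[of m] yd[of n] by simp
    finally show ?thesis .
  qed
  have "Cauchy y"
  proof (rule CauchyI)
    fix e :: real assume e: "e > 0"
    obtain N :: nat where N: "4 / e\<^sup>2 < N" using reals_Archimedean2 by blast
    have N': "4 / Suc N < e\<^sup>2"
    proof -
      have "4 < e\<^sup>2 * N" using N e by (simp add: field_simps)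
      also have "\<dots> \<le> e\<^sup>2 * Suc N" using e by (intro mult_left_mono) auto
      finally show ?thesis by (simp add: field_simps)
    qed
    show "\<exists>M. \<forall>m\<ge>M. \<forall>n\<ge>M. norm (y m - y n) < e"
    proof (intro exI allI impI)
      fix m n assume mn: "N \<le> m" "N \<le> n"
      have "2 / Suc m \<le> 2 / Suc N" "2 / Suc n \<le> 2 / Suc N"
        using mn by (intro divide_left_mono; simp)+
      then have "(norm (y m - y n))\<^sup>2 < e\<^sup>2" using par[of m n] N' by simp
      then show "norm (y m - y n) < e" using e by (simp add: power_less_imp_less_base)
    qed
  qed
  then obtain p where p: "y \<longlonglongrightarrow> p" using Cauchy_convergent convergent_def by blast
  have pW: "p \<in> W" using closed_sequentially[OF W(2) _ p] yW by blast
  have le_d: "(norm (x - p))\<^sup>2 \<le> d"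
  proof (rule LIMSEQ_le)
    show "(\<lambda>n. (norm (x - y n))\<^sup>2) \<longlonglongrightarrow> (norm (x - p))\<^sup>2" by (intro tendsto_intros p)
    show "(\<lambda>n. d + 1 / Suc n) \<longlonglongrightarrow> d"
      using tendsto_add[OF tendsto_const[of d] LIMSEQ_inverse_real_of_nat] by (simp add: divide_inverse)
    show "\<exists>N. \<forall>n\<ge>N. (norm (x - y n))\<^sup>2 \<le> d + 1 / Suc n" using yd less_imp_le by blast
  qed
  have min: "(norm (x - p))\<^sup>2 \<le> (norm (x - z))\<^sup>2" if "z \<in> W" for z
    using le_d dle[OF that] by (rule order_trans)
  have "(x - p) \<bullet> z = 0" if z: "z \<in> W" for z
  proof (cases "z = 0")
    case False
    define t where "t = ((x - p) \<bullet> z) / (z \<bullet> z)"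
    have "p + t *\<^sub>R z \<in> W" using W(1) pW z by (simp add: subspace_add subspace_scale)
    then have "(norm (x - p))\<^sup>2 \<le> (norm ((x - p) - t *\<^sub>R z))\<^sup>2"
      using min[of "p + t *\<^sub>R z"] by (simp add: diff_diff_eq)
    also have "\<dots> = (norm (x - p))\<^sup>2 - 2 * t * ((x - p) \<bullet> z) + t * t * (z \<bullet> z)"
      unfolding power2_norm_eq_inner
      by (simp add: inner_diff_left inner_diff_right inner_commute)
    also have "\<dots> = (norm (x - p))\<^sup>2 - ((x - p) \<bullet> z)\<^sup>2 / (z \<bullet> z)"
      using False by (simp add: t_def field_simps power2_eq_square)
    finally have "((x - p) \<bullet> z)\<^sup>2 / (z \<bullet> z) \<le> 0" by simp
    then show ?thesis using False
      by (smt (verit) divide_pos_pos inner_eq_zero_iff inner_ge_zero zero_less_power2)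
  qed simp
  then show ?thesis using pW by blast
qed

lemma riesz_representation:
  fixes f :: "'a::{real_inner,banach} \<Rightarrow> real"
  assumes f: "bounded_linear f"
  shows "\<exists>z. \<forall>x. f x = x \<bullet> z"
proof (cases "\<forall>x. f x = 0")
  case True
  then show ?thesis by (intro exI[of _ 0]) simp
next
  case False
  then obtain u where u: "f u \<noteq> 0" by blast
  interpret bounded_linear f by (rule f)
  let ?K = "{x. f x = 0}"
  have "subspace ?K" by (simp add: subspace_def add scaleR zero)
  moreover have "closed ?K" by (intro closed_Collect_eq continuous_intros linear_continuous_on f)
  ultimately obtain p where p: "p \<in> ?K" "\<forall>y\<in>?K. (u - p) \<bullet> y = 0"
    using projection_exists by blast
  define v where "v = u - p"
  have fv: "f v = f u" using p by (simp add: v_def diff)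
  have v0: "v \<noteq> 0" using fv u zero by auto
  have "f x = x \<bullet> ((f v / (v \<bullet> v)) *\<^sub>R v)" for x
  proof -
    have "f (x - (f x / f v) *\<^sub>R v) = 0" using fv u by (simp add: diff scaleR)
    then have "v \<bullet> (x - (f x / f v) *\<^sub>R v) = 0" using p(2) by (simp add: v_def)
    then have "v \<bullet> x = (f x / f v) * (v \<bullet> v)" by (simp add: inner_diff_right)
    then show ?thesis using v0 fv u by (simp add: inner_commute field_simps)
  qed
  then show ?thesis by blast
qed

lemma adj_works:
  fixes A :: "'a::{real_inner,banach} \<Rightarrow>\<^sub>L 'a"
  shows "A x \<bullet> y = x \<bullet> adj A y"
proof -
  have "\<exists>z. \<forall>x. A x \<bullet> y = x \<bullet> z" for y
    by (rule riesz_representation)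
      (intro bounded_linear_compose[OF bounded_linear_inner_left] blinfun.bounded_linear_right)
  then have ex: "\<exists>f'. \<forall>x y. A x \<bullet> y = x \<bullet> f' y" by metis
  let ?g = "adjoint (blinfun_apply A)"
  have g: "A x \<bullet> y = x \<bullet> ?g y" for x y
    unfolding adjoint_def using someI_ex[OF ex] by blast
  have "bounded_linear ?g"
  proof (rule bounded_linear_intro)
    fix y z :: 'a and r :: real
    have "x \<bullet> (?g (y + z) - (?g y + ?g z)) = 0" for x
      by (simp add: inner_diff_right inner_add_right flip: g)
    from this[of "?g (y + z) - (?g y + ?g z)"] show "?g (y + z) = ?g y + ?g z" by simp
    have "x \<bullet> (?g (r *\<^sub>R y) - r *\<^sub>R ?g y) = 0" for x
      by (simp add: inner_diff_right flip: g)
    from this[of "?g (r *\<^sub>R y) - r *\<^sub>R ?g y"] show "?g (r *\<^sub>R y) = r *\<^sub>R ?g y" by simp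
    have "norm (?g y) * norm (?g y) = A (?g y) \<bullet> y"
      by (simp add: g flip: power2_norm_eq_inner power2_eq_square)
    also have "\<dots> \<le> norm (A (?g y)) * norm y" by (rule norm_cauchy_schwarz)
    also have "\<dots> \<le> (norm A * norm (?g y)) * norm y"
      by (intro mult_right_mono norm_blinfun) simp
    finally have "norm (?g y) * norm (?g y) \<le> norm (?g y) * (norm y * norm A)"
      by (simp add: algebra_simps)
    then show "norm (?g y) \<le> norm y * norm A"
      by (cases "norm (?g y) = 0") (auto simp: mult_le_cancel_left)
  qed
  then show ?thesis by (simp add: adj_def bounded_linear_Blinfun_apply g)
qed

lemma adj_works_left: "adj A x \<bullet> y = x \<bullet> A y"
  by (metis adj_works inner_commute)

lemma subspace_closure_span: "subspace (closure (span E))" for E :: "'a::real_normed_vector set"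
proof (rule subspaceI)
  show "0 \<in> closure (span E)" using closure_subset span_zero by blast
next
  fix x y assume "x \<in> closure (span E)" "y \<in> closure (span E)"
  then obtain f g where "\<forall>n. f n \<in> span E" "f \<longlonglongrightarrow> x" "\<forall>n. g n \<in> span E" "g \<longlonglongrightarrow> y"
    unfolding closure_sequential by blast
  then show "x + y \<in> closure (span E)" unfolding closure_sequential
    by (intro exI[of _ "\<lambda>n. f n + g n"]) (auto intro: tendsto_add span_add)
next
  fix x :: 'a and c :: real assume "x \<in> closure (span E)"
  then obtain f where "\<forall>n. f n \<in> span E" "f \<longlonglongrightarrow> x"
    unfolding closure_sequential by blast
  then show "c *\<^sub>R x \<in> closure (span E)" unfolding closure_sequential
    by (intro exI[of _ "\<lambda>n. c *\<^sub>R f n"]) (auto intro: tendsto_scaleR span_scale)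
qed

lemma onb_exists:
  fixes W :: "'a::{real_inner,banach} set"
  assumes W: "subspace W" "closed W"
  shows "\<exists>E. is_onb W E"
proof -
  let ?A = "{E. E \<subseteq> W \<and> pairwise orthogonal E \<and> (\<forall>e\<in>E. norm e = 1)}"
  have "\<exists>M\<in>?A. \<forall>X\<in>?A. M \<subseteq> X \<longrightarrow> X = M"
  proof (rule subset_Zorn_nonempty)
    have "{} \<in> ?A" by simp
    then show "?A \<noteq> {}" by blast
  next
    fix C assume "subset.chain ?A C"
    then have C: "C \<subseteq> ?A" and ch: "\<And>X Y. X \<in> C \<Longrightarrow> Y \<in> C \<Longrightarrow> X \<subseteq> Y \<or> Y \<subseteq> X"
      unfolding subset_chain_def by auto
    have "pairwise orthogonal (\<Union>C)"
    proof (rule pairwiseI)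
      fix x y assume "x \<in> \<Union>C" "y \<in> \<Union>C" and ne: "x \<noteq> y"
      then obtain X Y where XY: "X \<in> C" "x \<in> X" "Y \<in> C" "y \<in> Y" by blast
      with ch[of X Y] obtain Z where "Z \<in> C" "x \<in> Z" "y \<in> Z" by blast
      then show "orthogonal x y" using C ne unfolding pairwise_def by blast
    qed
    then show "\<Union>C \<in> ?A" using C by blast
  qed
  then obtain E where E: "E \<in> ?A" and max0: "\<forall>X\<in>?A. E \<subseteq> X \<longrightarrow> X = E" by (rule bexE)
  have max: "X = E" if "X \<in> ?A" "E \<subseteq> X" for X
    using bspec[OF max0 that(1)] that(2) by (rule mp)
  have sub: "closure (span E) \<subseteq> W"
    using E W by (intro closure_minimal span_minimal) auto
  have "x \<in> closure (span E)" if x: "x \<in> W" for x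
  proof (rule ccontr)
    assume nx: "x \<notin> closure (span E)"
    obtain p where p: "p \<in> closure (span E)" "\<forall>y\<in>closure (span E). (x - p) \<bullet> y = 0"
      using projection_exists[OF subspace_closure_span closed_closure] by blast
    define u where "u = (1 / norm (x - p)) *\<^sub>R (x - p)"
    have n0: "norm (x - p) \<noteq> 0" using nx p by auto
    have u1: "norm u = 1" using n0 by (simp add: u_def)
    have uE: "u \<bullet> e = 0" if "e \<in> E" for e
    proof -
      have "e \<in> closure (span E)" using that span_superset closure_subset by blast
      then show ?thesis using p(2) by (simp add: u_def)
    qed
    have uW: "u \<in> W" unfolding u_def
      using W(1) x p(1) sub by (intro subspace_scale subspace_diff) auto
    have "insert u E \<in> ?A"
      using E u1 uE uW by (auto simp: pairwise_insert orthogonal_def inner_commute)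
    then have "insert u E = E" by (rule max) (rule subset_insertI)
    then have "u \<in> E" using insertI1[of u E] by simp
    then show False using uE[of u] u1 by simp
  qed
  then show ?thesis using E sub unfolding is_onb_def by (intro exI[of _ E]) auto
qed

lemma some_onb_UNIV: "is_onb UNIV (some_onb (UNIV :: 'a::{real_inner,banach} set))"
  unfolding some_onb_def by (rule someI_ex) (rule onb_exists; simp)

section \<open>The Hilbert space of Hilbert--Schmidt operators\<close>

lemma hilbert_schmidt_iff: "hilbert_schmidt A \<longleftrightarrow> (\<lambda>e. A e \<bullet> A e) summable_on some_onb UNIV"
  by (simp add: hilbert_schmidt_def adj_works inner_commute)

lemma hs_summable:
  assumes "hilbert_schmidt A" "hilbert_schmidt B"
  shows "(\<lambda>e. A e \<bullet> B e) summable_on some_onb UNIV"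
proof -
  have "(\<lambda>e. A e \<bullet> A e + B e \<bullet> B e) summable_on some_onb UNIV"
    using assms by (intro summable_on_add) (auto simp: hilbert_schmidt_iff)
  then have "(\<lambda>e. \<bar>A e \<bullet> B e\<bar>) summable_on some_onb UNIV"
  proof (rule summable_on_comparison_test)
    fix e
    have "0 \<le> (A e - B e) \<bullet> (A e - B e)" "0 \<le> (A e + B e) \<bullet> (A e + B e)"
      "0 \<le> A e \<bullet> A e" "0 \<le> B e \<bullet> B e" by (rule inner_ge_zero)+
    then show "\<bar>A e \<bullet> B e\<bar> \<le> A e \<bullet> A e + B e \<bullet> B e"
      by (simp add: inner_diff_left inner_diff_right inner_add_left inner_add_right inner_commute abs_le_iff)
  qed simp
  then show ?thesis by (rule summable_on_iff_abs_summable_on_real[THEN iffD2, unfolded real_norm_def])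
qed

lemma hilbert_schmidt_0: "hilbert_schmidt 0"
  by (simp add: hilbert_schmidt_iff)

lemma hilbert_schmidt_scaleR: "hilbert_schmidt A \<Longrightarrow> hilbert_schmidt (r *\<^sub>R A)"
  by (simp add: hilbert_schmidt_iff blinfun.scaleR_left summable_on_cmult_right)

lemma hilbert_schmidt_uminus: "hilbert_schmidt A \<Longrightarrow> hilbert_schmidt (- A)"
  using hilbert_schmidt_scaleR[of A "-1"] by simp

lemma hilbert_schmidt_add:
  assumes "hilbert_schmidt A" "hilbert_schmidt B"
  shows "hilbert_schmidt (A + B)"
proof -
  have "(\<lambda>e. (A e \<bullet> A e + A e \<bullet> B e) + (B e \<bullet> A e + B e \<bullet> B e)) summable_on some_onb UNIV"
    using assms by (intro summable_on_add hs_summable)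
  then show ?thesis
    by (simp add: hilbert_schmidt_iff blinfun.add_left inner_add_left inner_add_right algebra_simps)
qed

lemma hilbert_schmidt_diff:
  "hilbert_schmidt A \<Longrightarrow> hilbert_schmidt B \<Longrightarrow> hilbert_schmidt (A - B)"
  using hilbert_schmidt_add[of A "- B"] hilbert_schmidt_uminus[of B] by simp

typedef (overloaded) ('a::"{real_inner,banach}") hs = "{A :: 'a \<Rightarrow>\<^sub>L 'a. hilbert_schmidt A}"
  morphisms hs_op Hs
  using hilbert_schmidt_0 by blast

lemma hilbert_schmidt_hs_op: "hilbert_schmidt (hs_op a)"
  using hs_op by blast

lemma hs_op_Hs: "hilbert_schmidt A \<Longrightarrow> hs_op (Hs A) = A"
  by (simp add: Hs_inverse)

instantiation hs :: ("{real_inner,banach}") real_inner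
begin

definition zero_hs :: "'a hs" where "0 = Hs 0"
definition plus_hs :: "'a hs \<Rightarrow> 'a hs \<Rightarrow> 'a hs" where "a + b = Hs (hs_op a + hs_op b)"
definition minus_hs :: "'a hs \<Rightarrow> 'a hs \<Rightarrow> 'a hs" where "a - b = Hs (hs_op a - hs_op b)"
definition uminus_hs :: "'a hs \<Rightarrow> 'a hs" where "- a = Hs (- hs_op a)"
definition scaleR_hs :: "real \<Rightarrow> 'a hs \<Rightarrow> 'a hs" where "r *\<^sub>R a = Hs (r *\<^sub>R hs_op a)"
definition inner_hs :: "'a hs \<Rightarrow> 'a hs \<Rightarrow> real" where
  "a \<bullet> b = tr_on UNIV (adj (hs_op b) o\<^sub>L hs_op a)"
definition norm_hs :: "'a hs \<Rightarrow> real" where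
  "norm_hs a = sqrt (tr_on UNIV (adj (hs_op a) o\<^sub>L hs_op a))"
definition dist_hs :: "'a hs \<Rightarrow> 'a hs \<Rightarrow> real" where "dist_hs a b = norm (a - b)"
definition sgn_hs :: "'a hs \<Rightarrow> 'a hs" where "sgn_hs a = inverse (norm a) *\<^sub>R a"
definition uniformity_hs :: "('a hs \<times> 'a hs) filter" where
  "uniformity_hs = (INF e\<in>{0 <..}. principal {(x, y). dist x y < e})"
definition open_hs :: "'a hs set \<Rightarrow> bool" where
  "open_hs U \<longleftrightarrow> (\<forall>x\<in>U. eventually (\<lambda>(x', y). x' = x \<longrightarrow> y \<in> U) uniformity)"

lemma hs_op_simps:
  "hs_op (0 :: 'a hs) = 0"
  "hs_op (a + b :: 'a hs) = hs_op a + hs_op b"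
  "hs_op (a - b :: 'a hs) = hs_op a - hs_op b"
  "hs_op (- a :: 'a hs) = - hs_op a"
  "hs_op (r *\<^sub>R a :: 'a hs) = r *\<^sub>R hs_op a"
  unfolding zero_hs_def plus_hs_def minus_hs_def uminus_hs_def scaleR_hs_def
  by (intro hs_op_Hs hilbert_schmidt_0 hilbert_schmidt_add hilbert_schmidt_diff
      hilbert_schmidt_uminus hilbert_schmidt_scaleR hilbert_schmidt_hs_op)+

lemma inner_hs_eq: "(a :: 'a hs) \<bullet> b = (\<Sum>\<^sub>\<infinity>e\<in>some_onb UNIV. hs_op a e \<bullet> hs_op b e)"
  unfolding inner_hs_def tr_on_def by (simp add: adj_works_left)

lemma hs_eqI: "hs_op a = hs_op b \<Longrightarrow> a = (b :: 'a hs)"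
  by (simp add: hs_op_inject)

instance
proof
  fix a b c :: "'a hs" and r s :: real and U :: "'a hs set"
  show "a + b + c = a + (b + c)" "a + b = b + a" "0 + a = a" "- a + a = 0" "a - b = a + - b"
    "r *\<^sub>R (a + b) = r *\<^sub>R a + r *\<^sub>R b" "(r + s) *\<^sub>R a = r *\<^sub>R a + s *\<^sub>R a"
    "r *\<^sub>R s *\<^sub>R a = (r * s) *\<^sub>R a" "1 *\<^sub>R a = a"
    by (rule hs_eqI; simp add: hs_op_simps algebra_simps)+
  show "sgn a = inverse (norm a) *\<^sub>R a" "dist a b = norm (a - b)"
    "(uniformity :: ('a hs \<times> 'a hs) filter) = (INF e\<in>{0 <..}. principal {(x, y). dist x y < e})"
    "open U \<longleftrightarrow> (\<forall>x\<in>U. eventually (\<lambda>(x', y). x' = x \<longrightarrow> y \<in> U) uniformity)"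
    by (simp_all only: sgn_hs_def dist_hs_def uniformity_hs_def open_hs_def)
  show "a \<bullet> b = b \<bullet> a" by (simp add: inner_hs_eq inner_commute)
  show "(a + b) \<bullet> c = a \<bullet> c + b \<bullet> c"
    unfolding inner_hs_eq
    by (simp add: hs_op_simps blinfun.add_left inner_add_left infsum_add hs_summable hilbert_schmidt_hs_op)
  show "(r *\<^sub>R a) \<bullet> b = r * (a \<bullet> b)"
    unfolding inner_hs_eq by (simp add: hs_op_simps blinfun.scaleR_left infsum_cmult_right')
  show "0 \<le> a \<bullet> a" unfolding inner_hs_eq by (intro infsum_nonneg) simp
  show "norm a = sqrt (a \<bullet> a)" by (simp add: norm_hs_def inner_hs_def)
  show "a \<bullet> a = 0 \<longleftrightarrow> a = 0"
  proof
    assume "a \<bullet> a = 0"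
    then have z: "hs_op a e = 0" if "e \<in> some_onb UNIV" for e
      using nonneg_infsum_le_0D[of "\<lambda>e. hs_op a e \<bullet> hs_op a e" "some_onb UNIV" e] that
        hs_summable[OF hilbert_schmidt_hs_op hilbert_schmidt_hs_op, of a a]
      by (simp add: inner_hs_eq)
    let ?K = "{x. hs_op a x = 0}"
    have "closure (span (some_onb UNIV)) \<subseteq> ?K"
    proof (intro closure_minimal span_minimal)
      show "some_onb UNIV \<subseteq> ?K" using z by blast
      show "subspace ?K"
        by (simp add: subspace_def blinfun.add_right blinfun.scaleR_right blinfun.zero_right)
      show "closed ?K"
        by (intro closed_Collect_eq continuous_intros)
    qed
    then have "hs_op a x = 0" for x using some_onb_UNIV unfolding is_onb_def by blast
    then show "a = 0" by (intro hs_eqI blinfun_eqI) (simp add: hs_op_simps)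
  next
    assume "a = 0"
    then show "a \<bullet> a = 0" by (simp add: inner_hs_eq hs_op_simps)
  qed
qed

end

section \<open>The Lagrangian Grassmannian and the orbit\<close>

definition Sp :: "('a::{real_inner,banach} \<Rightarrow>\<^sub>L 'a) \<Rightarrow> ('a \<Rightarrow>\<^sub>L 'a) set" where
  "Sp J = {g. (\<exists>h. g o\<^sub>L h = id_blinfun \<and> h o\<^sub>L g = id_blinfun) \<and> adj g o\<^sub>L J o\<^sub>L g = J}"

definition Sp2 :: "('a::{real_inner,banach} \<Rightarrow>\<^sub>L 'a) \<Rightarrow> ('a \<Rightarrow>\<^sub>L 'a) set" where
  "Sp2 J = {g \<in> Sp J. hilbert_schmidt (g - id_blinfun)}"

definition sp2 :: "('a::{real_inner,banach} \<Rightarrow>\<^sub>L 'a) \<Rightarrow> ('a \<Rightarrow>\<^sub>L 'a) set" where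
  "sp2 J = {x. hilbert_schmidt x \<and> x o\<^sub>L J = - (J o\<^sub>L adj x)}"

definition lagrangian :: "('a::{real_inner,banach} \<Rightarrow>\<^sub>L 'a) \<Rightarrow> 'a set set" where
  "lagrangian J = {L. subspace L \<and> closed L \<and> J ` L = L\<^sup>\<bottom>}"

definition orbit :: "('a::{real_inner,banach} \<Rightarrow>\<^sub>L 'a) \<Rightarrow> 'a set \<Rightarrow> 'a set set" where
  "orbit J L0 = (\<lambda>g. blinfun_apply g ` L0) ` Sp2 J"

text \<open>An operator between closed subspaces \<open>V\<close> and \<open>W\<close> is represented by its extension by zero on
  \<open>V\<^sup>\<bottom>\<close>, as an operator on the whole space with range in \<open>W\<close>. This preserves sums, products, adjoints,
  traces and the Hilbert--Schmidt norm. The set below is thus the closed subspace of symmetric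
  Hilbert--Schmidt operators on \<open>W\<close>, and also the tangent space of the orbit at \<open>W\<close>.\<close>

definition B2s :: "'a::{real_inner,banach} set \<Rightarrow> 'a hs set" where
  "B2s W = {a. proj W o\<^sub>L hs_op a o\<^sub>L proj W = hs_op a \<and> adj (hs_op a) = hs_op a}"

definition Omega :: "('a::{real_inner,banach} \<Rightarrow>\<^sub>L 'a) \<Rightarrow> 'a set \<Rightarrow> 'a set set" where
  "Omega J L = {W \<in> lagrangian J. W \<inter> L\<^sup>\<bottom> = {0} \<and> (\<forall>x. \<exists>a\<in>W. \<exists>b\<in>L\<^sup>\<bottom>. x = a + b)}"

text \<open>The operator \<open>T\<close> from \<open>L\<close> to \<open>L\<^sup>\<bottom>\<close> with graph \<open>W\<close>.\<close>

definition graph_op :: "'a::{real_inner,banach} set \<Rightarrow> 'a set \<Rightarrow> ('a \<Rightarrow>\<^sub>L 'a)" where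
  "graph_op L W = (THE T :: 'a \<Rightarrow>\<^sub>L 'a. proj (L\<^sup>\<bottom>) o\<^sub>L T o\<^sub>L proj L = T \<and> W = {v + T v | v. v \<in> L})"

text \<open>The chart \<open>\<phi>\<^sub>L\<close> of the orbit around \<open>L\<close>, its domain and its inverse, defined on \<open>B2s L\<close>.\<close>

definition chart :: "('a::{real_inner,banach} \<Rightarrow>\<^sub>L 'a) \<Rightarrow> 'a set \<Rightarrow> 'a set \<Rightarrow> 'a hs" where
  "chart J L W = Hs (J o\<^sub>L graph_op L W)"

definition chart_dom :: "('a::{real_inner,banach} \<Rightarrow>\<^sub>L 'a) \<Rightarrow> 'a set \<Rightarrow> 'a set \<Rightarrow> 'a set set" where
  "chart_dom J L0 L = Omega J L \<inter> orbit J L0"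

definition chart_inv :: "('a::{real_inner,banach} \<Rightarrow>\<^sub>L 'a) \<Rightarrow> 'a set \<Rightarrow> 'a set \<Rightarrow> 'a hs \<Rightarrow> 'a set" where
  "chart_inv J L0 L = the_inv_into (chart_dom J L0 L) (chart J L)"

text \<open>The differential at the identity of \<open>g \<mapsto> g ` L\<close> from \<open>Sp2 J\<close> to the orbit, read in \<open>\<phi>\<^sub>L\<close>: for small
  \<open>t\<close>, \<open>(1 + t x) ` L\<close> is to first order the graph of \<open>t (proj (L\<^sup>\<bottom>)) x\<close> on \<open>L\<close>, and \<open>J\<close> times \<open>proj (L\<^sup>\<bottom>)\<close> is \<open>proj L\<close> times \<open>J\<close>.\<close>

definition d1_pi :: "('a::{real_inner,banach} \<Rightarrow>\<^sub>L 'a) \<Rightarrow> 'a set \<Rightarrow> ('a \<Rightarrow>\<^sub>L 'a) \<Rightarrow> ('a \<Rightarrow>\<^sub>L 'a)" where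
  "d1_pi J L x = proj L o\<^sub>L J o\<^sub>L x o\<^sub>L proj L"

section \<open>The ambient metric, its Levi-Civita connection and geodesics\<close>

definition ambient_metric :: "'a::{real_inner,banach} set \<Rightarrow> 'a hs \<Rightarrow> 'a hs \<Rightarrow> real" where
  "ambient_metric W v u = tr_on W (adj (hs_op u) o\<^sub>L hs_op v)"

text \<open>The ambient metric read in the chart \<open>\<phi>\<^sub>M\<close>. A vector \<open>h\<close> at the point \<open>x\<close> of the chart is the
  tangent vector at \<open>W = \<phi>\<^sub>M\<^sup>-\<^sup>1 x\<close> which the identification of the tangent space at \<open>W\<close> with \<open>B2s W\<close>,
  by the differential of \<open>\<phi>\<^sub>W\<close>, turns into the derivative of \<open>\<phi>\<^sub>W \<circ> \<phi>\<^sub>M\<^sup>-\<^sup>1\<close> at \<open>x\<close> in direction \<open>h\<close>.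
  The derivative within \<open>B2s M\<close> is determined on \<open>B2s M\<close> only, and only used there.\<close>

definition to_tangent ::
    "('a::{real_inner,banach} \<Rightarrow>\<^sub>L 'a) \<Rightarrow> 'a set \<Rightarrow> 'a set \<Rightarrow> 'a hs \<Rightarrow> 'a hs \<Rightarrow> 'a hs" where
  "to_tangent J L0 M x =
    frechet_derivative (\<lambda>y. chart J (chart_inv J L0 M x) (chart_inv J L0 M y)) (at x within B2s M)"

definition chart_metric ::
    "('a::{real_inner,banach} \<Rightarrow>\<^sub>L 'a) \<Rightarrow> 'a set \<Rightarrow> 'a set \<Rightarrow> 'a hs \<Rightarrow> 'a hs \<Rightarrow> 'a hs \<Rightarrow> real" where
  "chart_metric J L0 M x h k =
    ambient_metric (chart_inv J L0 M x) (to_tangent J L0 M x h) (to_tangent J L0 M x k)"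

text \<open>A connection on the orbit is given by its local representatives (Christoffel maps): in the chart
  \<open>\<phi>\<^sub>M\<close> the covariant derivative of a vector field \<open>Y\<close> at \<open>x\<close> in direction \<open>u\<close> is \<open>DY(x) u + \<Gamma> M x u (Y x)\<close>.
  It is the Levi-Civita connection iff it is torsion free (\<open>\<Gamma> M x\<close> is symmetric) and the metric is
  parallel. By the Koszul formula these conditions determine \<open>\<Gamma> M x\<close> on \<open>B2s M\<close> for each chart; the
  transformation rule of Christoffel maps under change of charts is a consequence.\<close>

definition levi_civita ::
    "('a::{real_inner,banach} \<Rightarrow>\<^sub>L 'a) \<Rightarrow> 'a set \<Rightarrow> ('a set \<Rightarrow> 'a hs \<Rightarrow> 'a hs \<Rightarrow> 'a hs \<Rightarrow> 'a hs) \<Rightarrow> bool"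
  where
  "levi_civita J L0 \<Gamma> \<longleftrightarrow> (\<forall>M\<in>orbit J L0. \<forall>x\<in>B2s M.
     (\<forall>u\<in>B2s M. \<forall>v\<in>B2s M. \<Gamma> M x u v \<in> B2s M) \<and>
     (\<forall>u\<in>B2s M. \<forall>v\<in>B2s M. \<forall>z\<in>B2s M. \<forall>r. \<Gamma> M x (r *\<^sub>R u + v) z = r *\<^sub>R \<Gamma> M x u z + \<Gamma> M x v z) \<and>
     (\<exists>K. \<forall>u\<in>B2s M. \<forall>v\<in>B2s M. norm (\<Gamma> M x u v) \<le> K * norm u * norm v) \<and>
     (\<forall>u\<in>B2s M. \<forall>v\<in>B2s M. \<Gamma> M x u v = \<Gamma> M x v u) \<and>
     (\<forall>h\<in>B2s M. \<forall>k\<in>B2s M. \<exists>D.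
        ((\<lambda>y. chart_metric J L0 M y h k) has_derivative D) (at x within B2s M) \<and>
        (\<forall>z\<in>B2s M. D z = chart_metric J L0 M x (\<Gamma> M x z h) k + chart_metric J L0 M x h (\<Gamma> M x z k))))"

text \<open>A curve on \<open>{0..1}\<close> is a geodesic if it is continuous and in every chart it is twice differentiable
  with vanishing covariant acceleration. Continuity is the openness of the preimages of the chart
  domains together with differentiability of the local representatives; the geodesic equation makes
  such a curve smooth.\<close>

definition geodesic ::
    "('a::{real_inner,banach} \<Rightarrow>\<^sub>L 'a) \<Rightarrow> 'a set \<Rightarrow> ('a set \<Rightarrow> 'a hs \<Rightarrow> 'a hs \<Rightarrow> 'a hs \<Rightarrow> 'a hs)
      \<Rightarrow> (real \<Rightarrow> 'a set) \<Rightarrow> bool" where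
  "geodesic J L0 \<Gamma> \<xi> \<longleftrightarrow>
     (\<forall>t\<in>{0..1}. \<xi> t \<in> orbit J L0) \<and>
     (\<forall>M\<in>orbit J L0.
        openin (top_of_set {0..1}) {t\<in>{0..1}. \<xi> t \<in> chart_dom J L0 M} \<and>
        (\<exists>x' x''. \<forall>t\<in>{0..1}. \<xi> t \<in> chart_dom J L0 M \<longrightarrow>
           ((\<lambda>s. chart J M (\<xi> s)) has_vector_derivative x' t) (at t within {0..1}) \<and>
           (x' has_vector_derivative x'' t) (at t within {0..1}) \<and>
           x'' t + \<Gamma> M (chart J M (\<xi> t)) (x' t) (x' t) = 0))"

definition has_velocity ::
    "('a::{real_inner,banach} \<Rightarrow>\<^sub>L 'a) \<Rightarrow> (real \<Rightarrow> 'a set) \<Rightarrow> real \<Rightarrow> 'a hs \<Rightarrow> bool" where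
  "has_velocity J \<xi> t w \<longleftrightarrow>
     ((\<lambda>s. chart J (\<xi> t) (\<xi> s)) has_vector_derivative w) (at t within {0..1})"

end

theory Submission
  imports Defs
begin

text \<open>The orbit is a Riemannian symmetric space of the group of orthogonal operators in \<open>Sp2 J\<close>,
  which commute with \<open>J\<close>. The proof combines the symmetry at each point with a conservation law.

  Write \<open>P\<close> for the projection onto a Lagrangian subspace \<open>M\<close>. In the chart centred at \<open>M\<close> the
  point \<open>x\<close> is the graph of \<open>- J x\<close> over \<open>M\<close>, and the reflection \<open>2 P - 1\<close> maps this graph to that
  of \<open>- x\<close>. Hence the coefficients of the metric in this chart are even functions of \<open>x\<close>
  (\<open>chart_metric_even\<close>), their derivative vanishes at the centre, and by the uniqueness part of
  the fundamental theorem of Riemannian geometry so does the Christoffel map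
  (\<open>christoffel_at_origin\<close>). A geodesic which is at \<open>M\<close> at time \<open>t\<close> therefore has zero second
  derivative at \<open>t\<close> in the chart centred at \<open>M\<close>. The metric is never differentiated by
  hand: its differentiability is part of the definition of the connection, and evenness gives the
  value of the derivative.

  To a tangent vector \<open>v\<close> at \<open>W\<close> belongs the skew operator \<open>J v + v J\<close>, which commutes with \<open>J\<close> and
  exchanges \<open>W\<close> and \<open>W\<^sup>\<bottom>\<close>. Along a geodesic this operator is a constant \<open>Y\<close>; this
  is the conservation law that belongs to the action of this group. It suffices to see
  that its derivative vanishes at each time \<open>t\<close>, which is a first order computation in the chart
  centred at \<open>\<xi> t\<close> (\<open>geodesic_momentum_and_projection\<close>). The same computation shows that the projection \<open>P t\<close>
  onto \<open>\<xi> t\<close> satisfies the linear equation \<open>P' = P Y - Y P\<close>. So \<open>P t\<close> is conjugate to \<open>P 0\<close> by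
  the exponential of \<open>- t Y\<close>, and \<open>\<xi> t\<close> is the image of \<open>L\<close> under it on the whole interval, without any
  continuation argument. Finally \<open>v = Y\<close> is skew, so the two exponents \<open>t (adj v - v)\<close> and
  \<open>- t (adj v)\<close> are \<open>- 2 t Y\<close> and \<open>t Y\<close>, which add up to \<open>- t Y\<close>.

  The computations rest on an explicit formula for the transition maps between the charts
  (\<open>chart_transition\<close>) and on the bijectivity of the charts onto \<open>B2s M\<close>
  (\<open>chart_domD\<close>, \<open>lag_graph_chart_dom\<close>).\<close>


section \<open>Operators on a real Hilbert space\<close>

lemma adj_eqI:
  assumes "\<And>x y. blinfun_apply A x \<bullet> y = x \<bullet> blinfun_apply B y"
  shows "adj A = B"
proof (rule blinfun_eqI)
  fix y
  have "x \<bullet> (adj A y - B y) = 0" for x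
    using assms[of x y] adj_works[of A x y] by (simp add: inner_diff_right)
  from this[of "adj A y - B y"] show "adj A y = B y" by simp
qed

lemma adj_adj [simp]: "adj (adj A) = A"
  by (rule adj_eqI) (rule adj_works_left)

lemma adj_simps [simp]:
  "adj (A o\<^sub>L B) = adj B o\<^sub>L adj A" "adj (A + B) = adj A + adj B"
  "adj (A - B) = adj A - adj B" "adj (- A) = - adj A" "adj (r *\<^sub>R A) = r *\<^sub>R adj A"
  "adj id_blinfun = id_blinfun"
  by (rule adj_eqI; simp add: adj_works inner_add_left inner_add_right
      inner_diff_left inner_diff_right blinfun.bilinear_simps)+

lemma orthogonal_compD: "x \<in> W\<^sup>\<bottom> \<Longrightarrow> y \<in> W \<Longrightarrow> x \<bullet> y = 0"
  by (auto simp: orthogonal_comp_def orthogonal_def inner_commute)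

lemma orthogonal_compI: "(\<And>y. y \<in> W \<Longrightarrow> x \<bullet> y = 0) \<Longrightarrow> x \<in> W\<^sup>\<bottom>"
  by (auto simp: orthogonal_comp_def orthogonal_def inner_commute)

lemma closed_orthogonal_comp: "closed (W\<^sup>\<bottom>)"
proof -
  have "W\<^sup>\<bottom> = (\<Inter>y\<in>W. {x. y \<bullet> x = 0})" by (auto simp: orthogonal_comp_def orthogonal_def)
  then show ?thesis by (auto intro!: closed_INT closed_Collect_eq continuous_intros)
qed

lemma orthogonal_decomposition_unique:
  assumes "subspace W" "a \<in> W" "x - a \<in> W\<^sup>\<bottom>" "b \<in> W" "x - b \<in> W\<^sup>\<bottom>"
  shows "a = b"
proof -
  have "a - b \<in> W" using assms by (simp add: subspace_diff)
  then have "(x - b) \<bullet> (a - b) = 0" "(x - a) \<bullet> (a - b) = 0"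
    using assms by (auto dest: orthogonal_compD)
  then have "(a - b) \<bullet> (a - b) = 0" by (simp add: inner_diff_left)
  then show ?thesis by simp
qed

lemma proj_works:
  fixes W :: "'a::{real_inner,banach} set"
  assumes W: "subspace W" "closed W"
  shows "proj W x \<in> W" "x - proj W x \<in> W\<^sup>\<bottom>"
proof -
  have "\<exists>p. p \<in> W \<and> x - p \<in> W\<^sup>\<bottom>" for x
    using projection_exists[OF W, of x] by (auto intro: orthogonal_compI)
  then obtain p where p: "\<And>x. p x \<in> W" "\<And>x. x - p x \<in> W\<^sup>\<bottom>" by metis
  note uniq = orthogonal_decomposition_unique[OF W(1)]
  have "bounded_linear p"
  proof (rule bounded_linear_intro[where K = 1])
    fix x y :: 'a and r :: real
    have "(x + y) - (p x + p y) = (x - p x) + (y - p y)" by simp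
    then have "(x + y) - (p x + p y) \<in> W\<^sup>\<bottom>"
      using p subspace_orthogonal_comp by (metis subspace_add)
    then show "p (x + y) = p x + p y"
      using p W by (intro uniq[of _ "x + y"]) (auto simp: subspace_add)
    have "r *\<^sub>R x - r *\<^sub>R p x = r *\<^sub>R (x - p x)" by (simp add: scaleR_diff_right)
    then have "r *\<^sub>R x - r *\<^sub>R p x \<in> W\<^sup>\<bottom>"
      using p subspace_orthogonal_comp by (metis subspace_scale)
    then show "p (r *\<^sub>R x) = r *\<^sub>R p x"
      using p W by (intro uniq[of _ "r *\<^sub>R x"]) (auto simp: subspace_scale)
    have "(x - p x) \<bullet> p x = 0" using p by (auto dest: orthogonal_compD)
    then have "(norm (p x))\<^sup>2 = x \<bullet> p x"
      by (simp add: inner_diff_left power2_norm_eq_inner)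
    also have "\<dots> \<le> norm x * norm (p x)" by (rule norm_cauchy_schwarz)
    finally have "norm (p x) = 0 \<or> norm (p x) \<le> norm x"
      by (auto simp: power2_eq_square mult_le_cancel_right)
    then show "norm (p x) \<le> norm x * 1" using norm_ge_zero[of x] by linarith
  qed
  then have ap: "blinfun_apply (Blinfun p) = p" by (rule bounded_linear_Blinfun_apply)
  have "\<exists>!P. \<forall>x. blinfun_apply P x \<in> W \<and> x - P x \<in> W\<^sup>\<bottom>"
  proof (rule ex1I[of _ "Blinfun p"])
    fix P assume "\<forall>x. blinfun_apply P x \<in> W \<and> x - P x \<in> W\<^sup>\<bottom>"
    then show "P = Blinfun p" by (intro blinfun_eqI) (auto simp: ap intro!: uniq p)
  qed (use p in \<open>simp add: ap\<close>)
  from theI'[OF this] show "proj W x \<in> W" "x - proj W x \<in> W\<^sup>\<bottom>" unfolding proj_def by auto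
qed

lemma proj_eqI:
  "subspace W \<Longrightarrow> closed W \<Longrightarrow> a \<in> W \<Longrightarrow> x - a \<in> W\<^sup>\<bottom> \<Longrightarrow> proj W x = a"
  by (rule orthogonal_decomposition_unique[of W _ x]) (auto simp: proj_works)

lemma proj_id: "subspace W \<Longrightarrow> closed W \<Longrightarrow> x \<in> W \<Longrightarrow> proj W x = x"
  by (rule proj_eqI) (auto simp: subspace_0 subspace_orthogonal_comp)

lemma proj_perp: "subspace W \<Longrightarrow> closed W \<Longrightarrow> x \<in> W\<^sup>\<bottom> \<Longrightarrow> proj W x = 0"
  by (rule proj_eqI) (auto simp: subspace_0)

lemma proj_range: "subspace W \<Longrightarrow> closed W \<Longrightarrow> range (proj W) = W"
  by (auto simp: proj_works) (metis proj_id rangeI)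

lemma adj_proj:
  assumes W: "subspace W" "closed W"
  shows "adj (proj W) = proj W"
proof (rule adj_eqI)
  fix x y
  have "proj W x \<bullet> y = proj W x \<bullet> proj W y"
    using orthogonal_compD[OF proj_works(2)[OF W, of y] proj_works(1)[OF W, of x]]
    by (simp add: inner_diff_left inner_commute[of "proj W x"])
  also have "\<dots> = x \<bullet> proj W y"
    using orthogonal_compD[OF proj_works(2)[OF W, of x] proj_works(1)[OF W, of y]]
    by (simp add: inner_diff_left)
  finally show "proj W x \<bullet> y = x \<bullet> proj W y" .
qed

lemma double_orthogonal_comp:
  fixes W :: "'a::{real_inner,banach} set"
  assumes W: "subspace W" "closed W"
  shows "W\<^sup>\<bottom>\<^sup>\<bottom> = W"
proof
  show "W \<subseteq> W\<^sup>\<bottom>\<^sup>\<bottom>" by (rule orthogonal_comp_subset)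
  show "W\<^sup>\<bottom>\<^sup>\<bottom> \<subseteq> W"
  proof
    fix x assume x: "x \<in> W\<^sup>\<bottom>\<^sup>\<bottom>"
    have "x - proj W x \<in> W\<^sup>\<bottom>\<^sup>\<bottom>"
      using x proj_works(1)[OF W] orthogonal_comp_subset subspace_orthogonal_comp
      by (metis subspace_diff subsetD)
    then have "(x - proj W x) \<bullet> (x - proj W x) = 0"
      using proj_works(2)[OF W] by (rule orthogonal_compD)
    then show "x \<in> W" using proj_works(1)[OF W, of x] by simp
  qed
qed

lemma proj_orthogonal_comp:
  fixes W :: "'a::{real_inner,banach} set"
  assumes W: "subspace W" "closed W"
  shows "proj (W\<^sup>\<bottom>) = id_blinfun - proj W"
proof (rule blinfun_eqI)
  fix x
  show "proj (W\<^sup>\<bottom>) x = (id_blinfun - proj W) x"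
    using proj_works[OF W, of x] double_orthogonal_comp[OF W]
    by (intro proj_eqI subspace_orthogonal_comp closed_orthogonal_comp)
      (auto simp: blinfun.bilinear_simps)
qed

text \<open>A coercive operator is injective with closed range, and a vector orthogonal to the range is
  orthogonal to its own image, hence zero.\<close>

lemma lax_milgram:
  fixes B :: "'a::{real_inner,banach} \<Rightarrow>\<^sub>L 'a"
  assumes c: "c > 0" and B: "\<And>u. c * (norm u)\<^sup>2 \<le> B u \<bullet> u"
  obtains C where "B o\<^sub>L C = id_blinfun" "C o\<^sub>L B = id_blinfun" "norm C \<le> 1 / c"
proof -
  have bound: "c * norm u \<le> norm (B u)" for u
  proof (cases "u = 0")
    case False
    have "c * (norm u)\<^sup>2 \<le> norm (B u) * norm u"
      using B[of u] norm_cauchy_schwarz[of "B u" u] by simp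
    then have "(c * norm u) * norm u \<le> norm (B u) * norm u" by (simp add: power2_eq_square mult.assoc)
    then show ?thesis using False by (simp add: mult_le_cancel_right)
  qed (simp add: blinfun.bilinear_simps)
  have sub: "subspace (range B)"
    by (metis blinfun.bounded_linear_right bounded_linear.linear linear_subspace_image subspace_UNIV)
  have "complete (range B)"
    by (rule complete_isometric_image[OF c _ blinfun.bounded_linear_right]) (auto simp: bound complete_UNIV)
  then have cl: "closed (range B)" by (rule complete_imp_closed)
  have surj: "\<exists>u. B u = z" for z
  proof -
    define r where "r = z - proj (range B) z"
    have "r \<bullet> B r = 0" unfolding r_def using proj_works(2)[OF sub cl] by (auto intro: orthogonal_compD)
    then have "r = 0" using B[of r] c by (simp add: inner_commute mult_le_0_iff)
    then have "z \<in> range B" using proj_works(1)[OF sub cl, of z] by (simp add: r_def)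
    then show ?thesis by auto
  qed
  define g where "g z = (SOME u. B u = z)" for z
  have g: "B (g z) = z" for z unfolding g_def using surj by (rule someI_ex)
  have inj: "u = v" if "B u = B v" for u v
    using bound[of "u - v"] c that by (simp add: blinfun.bilinear_simps mult_le_0_iff)
  have gB: "g (B u) = u" for u by (rule inj) (rule g)
  have bl: "bounded_linear g"
  proof (rule bounded_linear_intro[where K = "1 / c"])
    show "norm (g x) \<le> norm x * (1 / c)" for x
      using bound[of "g x"] c by (simp add: g field_simps)
    show "g (x + y) = g x + g y" "g (r *\<^sub>R x) = r *\<^sub>R g x" for x y r
      by (rule inj; simp add: g blinfun.bilinear_simps)+
  qed
  show ?thesis
  proof
    show "B o\<^sub>L Blinfun g = id_blinfun" "Blinfun g o\<^sub>L B = id_blinfun"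
      by (rule blinfun_eqI; simp add: bounded_linear_Blinfun_apply[OF bl] g gB)+
    show "norm (Blinfun g) \<le> 1 / c"
      using bound[of "g _"] c
      by (intro norm_blinfun_bound) (auto simp: bounded_linear_Blinfun_apply[OF bl] g field_simps)
  qed
qed

text \<open>An everywhere defined symmetric map is automatically bounded: the functionals \<open>x \<mapsto> x \<bullet> f y\<close> for \<open>y\<close>
  in the unit ball are pointwise bounded by symmetry, hence uniformly bounded on some ball by
  the Baire category theorem.\<close>

lemma hellinger_toeplitz:
  fixes f :: "'a::{real_inner,banach} \<Rightarrow> 'a"
  assumes sym: "\<And>x y. f x \<bullet> y = x \<bullet> f y"
  shows "bounded_linear f"
proof -
  have lin: "linear f"
  proof (rule linearI)
    fix x y :: 'a and r :: real
    have "(f (x + y) - (f x + f y)) \<bullet> z = 0" for z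
      by (simp add: inner_diff_left inner_add_left sym)
    from this[of "f (x + y) - (f x + f y)"] show "f (x + y) = f x + f y" by simp
    have "(f (r *\<^sub>R x) - r *\<^sub>R f x) \<bullet> z = 0" for z
      by (simp add: inner_diff_left sym)
    from this[of "f (r *\<^sub>R x) - r *\<^sub>R f x"] show "f (r *\<^sub>R x) = r *\<^sub>R f x" by simp
  qed
  define F where "F n = {x. \<forall>y. norm y \<le> 1 \<longrightarrow> x \<bullet> f y \<le> real n}" for n
  have cl: "closed (F n)" for n
  proof -
    have "F n = (\<Inter>y\<in>{y. norm y \<le> 1}. {x. x \<bullet> f y \<le> real n})" by (auto simp: F_def)
    then show ?thesis by (auto intro!: closed_INT closed_Collect_le continuous_intros)
  qed
  have cover: "\<Union>(range F) = UNIV"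
  proof -
    have "\<exists>n. x \<in> F n" for x
    proof -
      obtain n where n: "norm (f x) \<le> real n" using real_arch_simple by blast
      have "x \<bullet> f y \<le> real n" if "norm y \<le> 1" for y
      proof -
        have "x \<bullet> f y = f x \<bullet> y" by (simp add: sym)
        also have "\<dots> \<le> norm (f x) * norm y" by (rule norm_cauchy_schwarz)
        also have "\<dots> \<le> norm (f x) * 1" using that by (intro mult_left_mono) auto
        finally show ?thesis using n by simp
      qed
      then show ?thesis by (auto simp: F_def)
    qed
    then show ?thesis by auto
  qed
  \<comment> \<open>Baire: closed sets that cover the space cannot all have empty interior.\<close>
  have "\<exists>n. interior (F n) \<noteq> {}"
  proof (rule ccontr)
    assume "\<not> ?thesis"
    then have "Met_TC.mtopology interior_of \<Union>(range F) = {}"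
      using cl complete_UNIV by (intro Met_TC.metric_Baire_category_alt) auto
    then show False unfolding cover by simp
  qed
  then obtain n a e where e: "e > 0" "cball a e \<subseteq> F n"
    by (metis all_not_in_conv mem_interior_cball)
  have key: "z \<bullet> f y \<le> 2 * n" if "norm z \<le> e" "norm y \<le> 1" for z y
  proof -
    have "(a + z) \<bullet> f y \<le> n" "a \<bullet> f (- y) \<le> n"
      using e that by (auto simp: F_def subset_eq dist_norm)
    moreover have "f (- y) = - f y" using lin by (rule linear_neg)
    moreover have "(a + z) \<bullet> f y = a \<bullet> f y + z \<bullet> f y" by (simp add: inner_add_left)
    ultimately show ?thesis by simp
  qed
  have bd1: "norm (f y) \<le> 2 * n / e" if y: "norm y \<le> 1" for y
  proof (cases "f y = 0")
    case False
    have "((e / norm (f y)) *\<^sub>R f y) \<bullet> f y \<le> 2 * n"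
      using e y False by (intro key) auto
    then have "e * norm (f y) \<le> 2 * n"
      using False by (simp add: power2_norm_eq_inner[symmetric] power2_eq_square)
    then show ?thesis using e by (simp add: field_simps)
  qed (use e in simp)
  show ?thesis
  proof (rule bounded_linear_intro[where K = "2 * n / e"])
    fix x y :: 'a and r :: real
    show "f (x + y) = f x + f y" "f (r *\<^sub>R x) = r *\<^sub>R f x"
      using lin by (auto simp: linear_add linear_scale)
    show "norm (f x) \<le> norm x * (2 * n / e)"
    proof (cases "x = 0")
      case True then show ?thesis using linear_0[OF lin] by simp
    next
      case False
      have "norm (f ((1 / norm x) *\<^sub>R x)) \<le> 2 * n / e" using False by (intro bd1) auto
      then show ?thesis using False by (simp add: linear_scale[OF lin] field_simps)
    qed
  qed
qed


section \<open>Orthonormal bases and Hilbert--Schmidt operators\<close>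

text \<open>For \<open>c e = x \<bullet> e\<close> this is the inequality of Bessel. For general \<open>c\<close> it says that the Fourier
  coefficients give the best approximation, which turns density of the span into completeness.\<close>

lemma norm_diff_orthonormal_sum:
  fixes x :: "'a::real_inner"
  assumes F: "finite F" "pairwise orthogonal F" "\<forall>e\<in>F. norm e = 1"
  shows "(norm (x - (\<Sum>e\<in>F. c e *\<^sub>R e)))\<^sup>2 = (norm x)\<^sup>2 - (\<Sum>e\<in>F. (x \<bullet> e)\<^sup>2) + (\<Sum>e\<in>F. (x \<bullet> e - c e)\<^sup>2)"
proof -
  have inner: "(\<Sum>f\<in>F. c f * (f \<bullet> e)) = c e" if e: "e \<in> F" for e
  proof -
    have "c f * (f \<bullet> e) = (if f = e then c e else 0)" if "f \<in> F" for f
      using F e that by (auto simp: pairwise_def orthogonal_def norm_eq_1)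
    then have "(\<Sum>f\<in>F. c f * (f \<bullet> e)) = (\<Sum>f\<in>F. if f = e then c e else 0)" by (rule sum.cong[OF refl])
    then show ?thesis using F(1) e by simp
  qed
  let ?s = "\<Sum>e\<in>F. c e *\<^sub>R e"
  have "?s \<bullet> ?s = (\<Sum>e\<in>F. c e * (\<Sum>f\<in>F. c f * (f \<bullet> e)))"
    by (simp add: inner_sum_left inner_sum_right sum_distrib_left mult.left_commute inner_commute)
  also have "\<dots> = (\<Sum>e\<in>F. (c e)\<^sup>2)" by (simp add: inner power2_eq_square)
  finally have ss: "?s \<bullet> ?s = (\<Sum>e\<in>F. (c e)\<^sup>2)" .
  have xs: "x \<bullet> ?s = (\<Sum>e\<in>F. c e * (x \<bullet> e))" by (simp add: inner_sum_right)
  have "(norm (x - ?s))\<^sup>2 = x \<bullet> x - 2 * (x \<bullet> ?s) + ?s \<bullet> ?s"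
    by (simp add: power2_norm_eq_inner inner_diff_left inner_diff_right inner_commute)
  also have "\<dots> = (norm x)\<^sup>2 - (\<Sum>e\<in>F. (x \<bullet> e)\<^sup>2) + (\<Sum>e\<in>F. (x \<bullet> e - c e)\<^sup>2)"
    unfolding ss xs
    by (simp add: power2_diff power2_norm_eq_inner sum.distrib sum_subtractf sum_distrib_left mult_ac)
  finally show ?thesis .
qed

lemma parseval:
  fixes x :: "'a::{real_inner,banach}"
  assumes E: "is_onb W E" and x: "x \<in> W"
  shows "((\<lambda>e. (x \<bullet> e)\<^sup>2) has_sum (norm x)\<^sup>2) E"
proof -
  let ?f = "\<lambda>e. (x \<bullet> e)\<^sup>2"
  have on: "pairwise orthogonal F" "\<forall>e\<in>F. norm e = 1" if "F \<subseteq> E" for F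
    using E that by (auto simp: is_onb_def intro: pairwise_subset)
  have bessel: "sum ?f F \<le> (norm x)\<^sup>2" if "finite F" "F \<subseteq> E" for F
  proof -
    have "0 \<le> (norm (x - (\<Sum>e\<in>F. (x \<bullet> e) *\<^sub>R e)))\<^sup>2" by simp
    then show ?thesis
      using norm_diff_orthonormal_sum[OF that(1) on[OF that(2)], of x "\<lambda>e. x \<bullet> e"] by simp
  qed
  have summ: "?f summable_on E"
    by (rule nonneg_bdd_above_summable_on) (auto intro!: bdd_aboveI[of _ "(norm x)\<^sup>2"] bessel)
  have "infsum ?f E \<le> (norm x)\<^sup>2" by (rule infsum_le_finite_sums[OF summ bessel])
  moreover have "(norm x)\<^sup>2 \<le> infsum ?f E + \<epsilon>" if \<epsilon>: "\<epsilon> > 0" for \<epsilon>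
  proof -
    have "x \<in> closure (span E)" using E x by (simp add: is_onb_def)
    then obtain y where y: "y \<in> span E" "dist y x < sqrt \<epsilon>"
      using \<epsilon> unfolding closure_approachable by (metis real_sqrt_gt_zero)
    obtain F c where F: "finite F" "F \<subseteq> E" "(\<Sum>e\<in>F. c e *\<^sub>R e) = y"
      using y(1) unfolding span_explicit by blast
    have "norm (x - y) \<le> sqrt \<epsilon>" using y(2) by (simp add: dist_norm norm_minus_commute)
    then have "(norm (x - y))\<^sup>2 \<le> \<epsilon>"
      using \<epsilon> by (metis norm_ge_zero power_mono real_sqrt_pow2 less_imp_le)
    moreover have "(norm (x - y))\<^sup>2 \<ge> (norm x)\<^sup>2 - sum ?f F"
      using norm_diff_orthonormal_sum[OF F(1) on[OF F(2)], of x c] sum_nonneg[of F "\<lambda>e. (x \<bullet> e - c e)\<^sup>2"]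
      by (simp add: F(3))
    moreover have "sum ?f F \<le> infsum ?f E"
      by (rule finite_sum_le_infsum[OF summ F(1,2)]) simp
    ultimately show ?thesis by linarith
  qed
  then have "(norm x)\<^sup>2 \<le> infsum ?f E" by (rule field_le_epsilon)
  ultimately show ?thesis using summ by (metis has_sum_infsum order_antisym)
qed

text \<open>Both sides are iterated sums of \<open>(A e \<bullet> f)\<^sup>2\<close> over the two bases, which may be interchanged since
  the terms are nonnegative. Applied twice it also gives independence of the basis.\<close>

lemma hs_norm_swap:
  fixes A :: "'a::{real_inner,banach} \<Rightarrow>\<^sub>L 'a"
  assumes E: "is_onb W E" and F: "is_onb V F"
    and AV: "\<And>x. A x \<in> V" and AW: "\<And>x. adj A x \<in> W"
    and S: "((\<lambda>e. (norm (A e))\<^sup>2) has_sum S) E"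
  shows "((\<lambda>f. (norm (adj A f))\<^sup>2) has_sum S) F"
proof -
  let ?g = "\<lambda>(e, f). (A e \<bullet> f)\<^sup>2"
  have row: "((\<lambda>f. ?g (e, f)) has_sum (norm (A e))\<^sup>2) F" for e
    using parseval[OF F AV] by simp
  have "?g summable_on (E \<times> F)"
    using S by (intro summable_on_SigmaI[OF row]) (auto simp: summable_on_def)
  then have "(?g has_sum S) (E \<times> F)" using row S by (intro has_sum_SigmaI)
  then have sw: "((\<lambda>(f, e). (A e \<bullet> f)\<^sup>2) has_sum S) (F \<times> E)"
    by (subst (asm) has_sum_swap) simp
  have "((\<lambda>e. (\<lambda>(f, e). (A e \<bullet> f)\<^sup>2) (f, e)) has_sum (norm (adj A f))\<^sup>2) E" for f
    using parseval[OF E AW, of f] by (simp add: adj_works_left inner_commute[of f])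
  from has_sum_SigmaD[OF sw this] show ?thesis .
qed

lemma hs_has_sum: "((\<lambda>e. (norm (hs_op a e))\<^sup>2) has_sum (norm a)\<^sup>2) (some_onb UNIV)"
proof -
  have "(norm a)\<^sup>2 = (\<Sum>\<^sub>\<infinity>e\<in>some_onb UNIV. (norm (hs_op a e))\<^sup>2)"
    by (simp add: power2_norm_eq_inner inner_hs_eq)
  moreover have "(\<lambda>e. (norm (hs_op a e))\<^sup>2) summable_on some_onb UNIV"
    using hilbert_schmidt_hs_op[of a] by (simp add: hilbert_schmidt_iff power2_norm_eq_inner)
  ultimately show ?thesis by simp
qed

lemma hilbert_schmidt_adj: "hilbert_schmidt A \<Longrightarrow> hilbert_schmidt (adj A)"
  using hs_norm_swap[OF some_onb_UNIV some_onb_UNIV, of A] hs_has_sum[of "Hs A"]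
  by (auto simp: hs_op_Hs hilbert_schmidt_iff power2_norm_eq_inner summable_on_def)

lemma hs_has_sum_adj:
  assumes "is_onb V F" "\<And>x. hs_op a x \<in> V"
  shows "((\<lambda>f. (norm (adj (hs_op a) f))\<^sup>2) has_sum (norm a)\<^sup>2) F"
  using hs_norm_swap[OF some_onb_UNIV assms(1), of "hs_op a"] assms(2) hs_has_sum[of a] by simp

lemma norm_Hs_adj: "norm (Hs (adj (hs_op a))) = norm a"
proof -
  have "((\<lambda>f. (norm (adj (hs_op a) f))\<^sup>2) has_sum (norm a)\<^sup>2) (some_onb UNIV)"
    by (rule hs_has_sum_adj[OF some_onb_UNIV]) simp
  moreover have "((\<lambda>f. (norm (adj (hs_op a) f))\<^sup>2) has_sum (norm (Hs (adj (hs_op a))))\<^sup>2) (some_onb UNIV)"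
    using hs_has_sum[of "Hs (adj (hs_op a))"] by (simp add: hs_op_Hs hilbert_schmidt_adj hilbert_schmidt_hs_op)
  ultimately have "(norm (Hs (adj (hs_op a))))\<^sup>2 = (norm a)\<^sup>2" by (metis has_sum_unique)
  then show ?thesis by (simp add: power2_eq_iff_nonneg)
qed

lemma hs_has_sum_onb:
  assumes W: "subspace W" "closed W" "is_onb W E" and aW: "\<And>x. adj (hs_op a) x \<in> W"
  shows "((\<lambda>e. (norm (hs_op a e))\<^sup>2) has_sum (norm a)\<^sup>2) E"
proof -
  let ?b = "Hs (adj (hs_op a))"
  have b: "hs_op ?b = adj (hs_op a)" by (simp add: hs_op_Hs hilbert_schmidt_adj hilbert_schmidt_hs_op)
  show ?thesis using hs_has_sum_adj[of W E ?b] W aW by (simp add: b norm_Hs_adj)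
qed

lemma some_onb: "subspace W \<Longrightarrow> closed W \<Longrightarrow> is_onb W (some_onb W)"
  unfolding some_onb_def by (rule someI_ex) (rule onb_exists)

lemma polarization:
  "(1/4) * (norm (u + v))\<^sup>2 + (-1/4) * (norm (u - v))\<^sup>2 = u \<bullet> (v :: 'a::real_inner)"
  by (simp add: power2_norm_eq_inner inner_add_left inner_add_right inner_diff_left inner_diff_right
      inner_commute field_simps)

text \<open>The ambient metric is defined by a trace over \<open>W\<close>, the norm on \<open>hs\<close> by a trace over the whole
  space. They agree for operators that vanish on \<open>W\<^sup>\<bottom>\<close>, expressed here by the range of the adjoint.\<close>

lemma tr_on_eq_inner:
  assumes W: "subspace W" "closed W"
    and aW: "\<And>x. adj (hs_op a) x \<in> W" and bW: "\<And>x. adj (hs_op b) x \<in> W"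
  shows "tr_on W (adj (hs_op b) o\<^sub>L hs_op a) = a \<bullet> b"
proof -
  have "((\<lambda>e. (1/4) * (norm (hs_op (a + b) e))\<^sup>2 + (-1/4) * (norm (hs_op (a - b) e))\<^sup>2) has_sum
      (1/4) * (norm (a + b))\<^sup>2 + (-1/4) * (norm (a - b))\<^sup>2) (some_onb W)"
    using W aW bW
    by (intro has_sum_add has_sum_cmult_right hs_has_sum_onb[OF W some_onb])
      (auto simp: hs_op_simps blinfun.bilinear_simps subspace_add subspace_diff)
  then have "((\<lambda>e. hs_op a e \<bullet> hs_op b e) has_sum a \<bullet> b) (some_onb W)"
    by (simp only: hs_op_simps blinfun.bilinear_simps polarization)
  then show ?thesis unfolding tr_on_def by (simp add: adj_works_left infsumI)
qed

lemma norm_adj_le: "norm (adj A) \<le> norm A"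
proof (rule norm_blinfun_bound)
  fix y
  have "(norm (adj A y))\<^sup>2 = A (adj A y) \<bullet> y" by (simp add: adj_works power2_norm_eq_inner)
  also have "\<dots> \<le> norm (A (adj A y)) * norm y" by (rule norm_cauchy_schwarz)
  also have "\<dots> \<le> (norm A * norm (adj A y)) * norm y" by (intro mult_right_mono norm_blinfun) simp
  finally have "norm (adj A y) * norm (adj A y) \<le> norm (adj A y) * (norm A * norm y)"
    by (simp add: power2_eq_square algebra_simps)
  then have "norm (adj A y) = 0 \<or> norm (adj A y) \<le> norm A * norm y"
    by (auto simp: mult_le_cancel_left)
  moreover have "0 \<le> norm A * norm y" by simp
  ultimately show "norm (adj A y) \<le> norm A * norm y" by linarith
qed simp

lemma norm_adj: "norm (adj A) = norm A"
  using norm_adj_le[of A] norm_adj_le[of "adj A"] by simp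

lemma hs_compose_left:
  assumes "hilbert_schmidt B"
  shows "hilbert_schmidt (A o\<^sub>L B)" "norm (Hs (A o\<^sub>L B)) \<le> norm A * norm (Hs B)"
proof -
  have B: "((\<lambda>e. (norm A)\<^sup>2 * (norm (B e))\<^sup>2) has_sum (norm A)\<^sup>2 * (norm (Hs B))\<^sup>2) (some_onb UNIV)"
    using hs_has_sum[of "Hs B"] assms by (intro has_sum_cmult_right) (simp add: hs_op_Hs)
  have le: "(norm (A (B e)))\<^sup>2 \<le> (norm A)\<^sup>2 * (norm (B e))\<^sup>2" for e
    using power_mono[OF norm_blinfun[of A "B e"], of 2] by (simp add: power_mult_distrib)
  have "(\<lambda>e. (norm (A (B e)))\<^sup>2) summable_on some_onb UNIV"
    by (rule summable_on_comparison_test[OF has_sum_imp_summable[OF B]]) (auto simp: le)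
  then show hs: "hilbert_schmidt (A o\<^sub>L B)" by (simp add: hilbert_schmidt_iff power2_norm_eq_inner)
  have "(norm (Hs (A o\<^sub>L B)))\<^sup>2 \<le> (norm A)\<^sup>2 * (norm (Hs B))\<^sup>2"
    using has_sum_mono[OF hs_has_sum[of "Hs (A o\<^sub>L B)"] B] le by (simp add: hs_op_Hs hs)
  then have "(norm (Hs (A o\<^sub>L B)))\<^sup>2 \<le> (norm A * norm (Hs B))\<^sup>2" by (simp add: power_mult_distrib)
  then show "norm (Hs (A o\<^sub>L B)) \<le> norm A * norm (Hs B)" by (rule power2_le_imp_le) simp
qed

lemma hs_compose_right:
  assumes "hilbert_schmidt A"
  shows "hilbert_schmidt (A o\<^sub>L B)" "norm (Hs (A o\<^sub>L B)) \<le> norm (Hs A) * norm B"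
proof -
  have *: "hilbert_schmidt (adj B o\<^sub>L adj A)" by (intro hs_compose_left hilbert_schmidt_adj assms)
  from hilbert_schmidt_adj[OF this] show hs: "hilbert_schmidt (A o\<^sub>L B)" by simp
  have "norm (Hs (A o\<^sub>L B)) = norm (Hs (adj B o\<^sub>L adj A))"
    using norm_Hs_adj[of "Hs (A o\<^sub>L B)"] by (simp add: hs_op_Hs hs)
  also have "\<dots> \<le> norm (adj B) * norm (Hs (adj A))" by (intro hs_compose_left hilbert_schmidt_adj assms)
  also have "\<dots> = norm (Hs A) * norm B"
    using norm_Hs_adj[of "Hs A"] assms by (simp add: hs_op_Hs norm_adj)
  finally show "norm (Hs (A o\<^sub>L B)) \<le> norm (Hs A) * norm B" .
qed

text \<open>By this bound every derivative in the Hilbert--Schmidt norm is also one in the operator norm, in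
  which the flow of the geodesic is computed.\<close>

lemma norm_hs_op_le: "norm (hs_op a) \<le> norm a"
proof (rule norm_blinfun_bound)
  fix v
  have "(norm (hs_op a v))\<^sup>2 \<le> (norm v)\<^sup>2 * (norm a)\<^sup>2"
  proof (rule has_sum_mono)
    show "((\<lambda>f. (hs_op a v \<bullet> f)\<^sup>2) has_sum (norm (hs_op a v))\<^sup>2) (some_onb UNIV)"
      by (rule parseval[OF some_onb_UNIV]) simp
    show "((\<lambda>f. (norm v)\<^sup>2 * (norm (adj (hs_op a) f))\<^sup>2) has_sum (norm v)\<^sup>2 * (norm a)\<^sup>2) (some_onb UNIV)"
      by (intro has_sum_cmult_right hs_has_sum_adj[OF some_onb_UNIV]) simp
    show "(hs_op a v \<bullet> f)\<^sup>2 \<le> (norm v)\<^sup>2 * (norm (adj (hs_op a) f))\<^sup>2" for f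
      using power_mono[OF Cauchy_Schwarz_ineq2[of v "adj (hs_op a) f"], of 2]
      by (simp add: adj_works power_mult_distrib)
  qed
  then have "(norm (hs_op a v))\<^sup>2 \<le> (norm a * norm v)\<^sup>2" by (simp add: power_mult_distrib mult.commute)
  then show "norm (hs_op a v) \<le> norm a * norm v" by (rule power2_le_imp_le) simp
qed simp

lemma bounded_linear_hs_op: "bounded_linear hs_op"
  by (rule bounded_linear_intro[where K = 1]) (auto simp: hs_op_simps norm_hs_op_le)

text \<open>The differentials of all the maps between charts have this form.\<close>

definition sandwich :: "('a::{real_inner,banach} \<Rightarrow>\<^sub>L 'a) \<Rightarrow> ('a \<Rightarrow>\<^sub>L 'a) \<Rightarrow> 'a hs \<Rightarrow> 'a hs" where
  "sandwich B C a = Hs (B o\<^sub>L hs_op a o\<^sub>L C)"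

lemma hs_op_sandwich [simp]: "hs_op (sandwich B C a) = B o\<^sub>L hs_op a o\<^sub>L C"
  unfolding sandwich_def
  by (intro hs_op_Hs hs_compose_left hs_compose_right hilbert_schmidt_hs_op)

lemma norm_sandwich_le: "norm (sandwich B C a) \<le> norm B * norm C * norm a"
proof -
  have "norm (sandwich B C a) \<le> norm (Hs (B o\<^sub>L hs_op a)) * norm C"
    unfolding sandwich_def by (intro hs_compose_left hs_compose_right hilbert_schmidt_hs_op)
  also have "norm (Hs (B o\<^sub>L hs_op a)) \<le> norm B * norm (Hs (hs_op a))"
    by (intro hs_compose_left hilbert_schmidt_hs_op)
  finally show ?thesis by (simp add: hs_op_inverse mult_right_mono mult_ac)
qed

lemma bounded_linear_sandwich: "bounded_linear (sandwich B C)"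
proof (rule bounded_linear_intro[where K = "norm B * norm C"])
  show "norm (sandwich B C x) \<le> norm x * (norm B * norm C)" for x
    using norm_sandwich_le[of B C x] by (simp add: mult_ac)
qed (auto intro!: hs_eqI blinfun_eqI simp: hs_op_simps blinfun.bilinear_simps)

lemma inner_Hs_adj: "Hs (adj (hs_op a)) \<bullet> Hs (adj (hs_op b)) = a \<bullet> b"
proof -
  have lin: "Hs (adj (hs_op (a + b))) = Hs (adj (hs_op a)) + Hs (adj (hs_op b))"
    by (intro hs_eqI) (simp add: hs_op_simps hs_op_Hs hilbert_schmidt_adj hilbert_schmidt_hs_op
        hilbert_schmidt_add)
  have "(norm (Hs (adj (hs_op (a + b)))))\<^sup>2 = (norm (a + b))\<^sup>2" by (simp only: norm_Hs_adj)
  then have "(norm (Hs (adj (hs_op a)) + Hs (adj (hs_op b))))\<^sup>2 = (norm (a + b))\<^sup>2" by (simp only: lin)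
  moreover have "(norm (Hs (adj (hs_op a))))\<^sup>2 = (norm a)\<^sup>2" "(norm (Hs (adj (hs_op b))))\<^sup>2 = (norm b)\<^sup>2"
    by (simp_all only: norm_Hs_adj)
  ultimately show ?thesis
    by (simp add: power2_norm_eq_inner inner_add_left inner_add_right inner_commute)
qed

text \<open>Left multiplication by an isometry preserves the inner product of Hilbert--Schmidt operators
  termwise, and the adjoint is an isometry, which gives right multiplication as well.\<close>

lemma inner_sandwich_isometry:
  assumes "adj U o\<^sub>L U = id_blinfun"
  shows "sandwich U (adj U) a \<bullet> sandwich U (adj U) b = a \<bullet> b"
proof -
  have left: "sandwich U id_blinfun a \<bullet> sandwich U id_blinfun b = a \<bullet> b" for a b
  proof -
    have "U x \<bullet> U y = x \<bullet> y" for x y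
      using arg_cong[OF assms, of "\<lambda>A. blinfun_apply A y"] by (simp add: adj_works)
    then show ?thesis by (simp add: inner_hs_eq)
  qed
  let ?c = "\<lambda>a. Hs (adj (hs_op a))"
  \<comment> \<open>right multiplication by \<open>adj U\<close> is left multiplication by \<open>U\<close> conjugated with the adjoint\<close>
  have eq: "sandwich U (adj U) a = sandwich U id_blinfun (?c (sandwich U id_blinfun (?c a)))" for a
    by (intro hs_eqI) (auto intro!: blinfun_eqI
      simp: hs_op_Hs hilbert_schmidt_adj hilbert_schmidt_hs_op hs_compose_left hs_compose_right)
  show ?thesis unfolding eq by (simp only: left inner_Hs_adj)
qed


section \<open>Graphs over a Lagrangian subspace\<close>

locale complex_structure =
  fixes J :: "'a::{real_inner,banach} \<Rightarrow>\<^sub>L 'a"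
  assumes J_square: "J o\<^sub>L J = - id_blinfun" and J_adj: "adj J = - J"
begin

lemma JJ [simp]: "J (J x) = - x"
  using arg_cong[OF J_square, of "\<lambda>A. blinfun_apply A x"] by (simp add: blinfun.bilinear_simps)

lemma inner_J: "J x \<bullet> y = - (x \<bullet> J y)"
  by (simp add: adj_works J_adj blinfun.bilinear_simps)

lemma lagrangianD:
  assumes "L \<in> lagrangian J"
  shows "subspace L" "closed L" "x \<in> L \<Longrightarrow> J x \<in> L\<^sup>\<bottom>" "x \<in> L\<^sup>\<bottom> \<Longrightarrow> J x \<in> L"
proof -
  show L: "subspace L" "closed L" and "x \<in> L \<Longrightarrow> J x \<in> L\<^sup>\<bottom>"
    using assms by (auto simp: lagrangian_def)
  show "J x \<in> L" if "x \<in> L\<^sup>\<bottom>"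
  proof -
    have "x \<in> J ` L" using that assms by (simp add: lagrangian_def)
    then obtain l where "l \<in> L" "x = J l" by blast
    then show ?thesis using L by (simp add: subspace_neg)
  qed
qed

lemma proj_J:
  assumes L: "L \<in> lagrangian J"
  shows "proj L (J x) = J x - J (proj L x)"
proof -
  note LD = lagrangianD[OF L]
  have "J (x - proj L x) \<in> L" using proj_works(2)[OF LD(1,2)] by (rule LD(4))
  moreover have "J (proj L x) \<in> L\<^sup>\<bottom>" using proj_works(1)[OF LD(1,2)] by (rule LD(3))
  ultimately show ?thesis
    by (intro proj_eqI LD) (auto simp: blinfun.bilinear_simps)
qed

lemma Sp2_preserves_J:
  assumes "g \<in> Sp2 J"
  shows "adj g (J (g x)) = J x"
proof -
  have "adj g o\<^sub>L J o\<^sub>L g = J" using assms by (simp add: Sp2_def Sp_def)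
  from arg_cong[OF this, of "\<lambda>A. blinfun_apply A x"] show ?thesis by simp
qed

lemma Sp2_inverse:
  assumes "g \<in> Sp2 J"
  shows "\<exists>h\<in>Sp2 J. (\<forall>x. g (h x) = x) \<and> (\<forall>x. h (g x) = x)"
proof -
  obtain h where h: "g o\<^sub>L h = id_blinfun" "h o\<^sub>L g = id_blinfun"
    and hs: "hilbert_schmidt (g - id_blinfun)"
    using assms unfolding Sp2_def Sp_def by blast
  have gh: "g (h x) = x" "h (g x) = x" for x
    using arg_cong[OF h(1), of "\<lambda>A. blinfun_apply A x"] arg_cong[OF h(2), of "\<lambda>A. blinfun_apply A x"]
    by auto
  have "adj h o\<^sub>L adj g = id_blinfun" using arg_cong[OF h(1), of adj] by simp
  then have ahg: "adj h (adj g x) = x" for x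
    by (metis blinfun_apply_blinfun_compose blinfun_apply_id_blinfun id_apply)
  note gJ' = Sp2_preserves_J[OF assms]
  have "adj h (J (h x)) = J x" for x
    using gJ'[of "h x", symmetric] by (simp add: ahg gh)
  then have "adj h o\<^sub>L J o\<^sub>L h = J" by (intro blinfun_eqI) simp
  moreover have "h - id_blinfun = - (h o\<^sub>L (g - id_blinfun))"
    by (rule blinfun_eqI) (simp add: blinfun.bilinear_simps gh)
  then have "hilbert_schmidt (h - id_blinfun)"
    using hs by (simp add: hilbert_schmidt_uminus hs_compose_left)
  ultimately have "h \<in> Sp2 J" using h by (auto simp: Sp2_def Sp_def)
  then show ?thesis using gh by blast
qed

lemma Sp2_compose:
  assumes g: "g \<in> Sp2 J" and k: "k \<in> Sp2 J"
  shows "g o\<^sub>L k \<in> Sp2 J"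
proof -
  obtain h where "h \<in> Sp2 J" and h: "\<And>x. g (h x) = x" "\<And>x. h (g x) = x" using Sp2_inverse[OF g] by blast
  obtain m where "m \<in> Sp2 J" and m: "\<And>x. k (m x) = x" "\<And>x. m (k x) = x" using Sp2_inverse[OF k] by blast
  have "adj (g o\<^sub>L k) o\<^sub>L J o\<^sub>L (g o\<^sub>L k) = J"
    by (intro blinfun_eqI) (simp add: Sp2_preserves_J[OF g] Sp2_preserves_J[OF k])
  moreover have "\<exists>n. (g o\<^sub>L k) o\<^sub>L n = id_blinfun \<and> n o\<^sub>L (g o\<^sub>L k) = id_blinfun"
    by (intro exI[of _ "m o\<^sub>L h"] conjI blinfun_eqI) (simp_all add: h m)
  moreover have "hilbert_schmidt ((g o\<^sub>L k) - id_blinfun)"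
  proof -
    have "(g o\<^sub>L k) - id_blinfun = ((g - id_blinfun) o\<^sub>L k) + (k - id_blinfun)"
      by (rule blinfun_eqI) (simp add: blinfun.bilinear_simps)
    moreover have "hilbert_schmidt (((g - id_blinfun) o\<^sub>L k) + (k - id_blinfun))"
      using g k by (intro hilbert_schmidt_add hs_compose_right) (auto simp: Sp2_def)
    ultimately show ?thesis by (simp only:)
  qed
  ultimately show ?thesis by (simp add: Sp2_def Sp_def)
qed

text \<open>On \<open>(g ` L)\<^sup>\<bottom>\<close> the adjoint of \<open>g\<close> takes values in \<open>L\<^sup>\<bottom> = J ` L\<close>, and \<open>adj g\<close> is injective with
  \<open>adj g o\<^sub>L J o\<^sub>L g = J\<close>.\<close>

lemma Sp2_image_lagrangian:
  assumes g: "g \<in> Sp2 J" and L: "L \<in> lagrangian J"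
  shows "g ` L \<in> lagrangian J"
proof -
  note LD = lagrangianD[OF L]
  obtain h where h: "h \<in> Sp2 J" "\<And>x. g (h x) = x" "\<And>x. h (g x) = x" using Sp2_inverse[OF g] by blast
  note gJ = Sp2_preserves_J[OF g]
  have inj: "x = y" if "adj g x = adj g y" for x y
  proof -
    have "(x - y) \<bullet> g (h (x - y)) = adj g (x - y) \<bullet> h (x - y)" by (rule adj_works_left[symmetric])
    also have "\<dots> = 0" using that by (simp add: blinfun.diff_right)
    finally show ?thesis by (simp add: h)
  qed
  have img: "g ` L = h -` L"
  proof
    show "g ` L \<subseteq> h -` L" by (auto simp: h)
    show "h -` L \<subseteq> g ` L" by (metis h(2) image_eqI subsetI vimage_eq)
  qed
  have "subspace (g ` L)"
    by (metis LD(1) blinfun.bounded_linear_right bounded_linear.linear linear_subspace_image)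
  moreover have "closed (g ` L)" unfolding img
    by (intro closed_vimage LD continuous_intros)
  moreover have "J ` (g ` L) = (g ` L)\<^sup>\<bottom>"
  proof
    show "J ` (g ` L) \<subseteq> (g ` L)\<^sup>\<bottom>"
    proof (clarsimp, rule orthogonal_compI, clarsimp)
      fix x y assume "x \<in> L" "y \<in> L"
      then have "J x \<bullet> y = 0" using LD(3) by (blast dest: orthogonal_compD)
      then show "J (g x) \<bullet> g y = 0" using adj_works_left[of g "J (g x)" y] by (simp add: gJ)
    qed
    show "(g ` L)\<^sup>\<bottom> \<subseteq> J ` (g ` L)"
    proof
      fix z assume z: "z \<in> (g ` L)\<^sup>\<bottom>"
      have "adj g z \<in> L\<^sup>\<bottom>" 
      proof (rule orthogonal_compI)
        fix y assume "y \<in> L"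
        then show "adj g z \<bullet> y = 0"
          using orthogonal_compD[OF z, of "g y"] by (simp add: adj_works_left)
      qed
      then have "adj g z \<in> J ` L" using L by (simp add: lagrangian_def)
      then obtain l where l: "l \<in> L" "adj g z = J l" by blast
      then have "adj g z = adj g (J (g l))" by (simp add: gJ)
      then have "z = J (g l)" by (rule inj)
      then show "z \<in> J ` (g ` L)" using l by blast
    qed
  qed
  ultimately show ?thesis by (simp add: lagrangian_def)
qed

lemma orbit_lagrangian: "L0 \<in> lagrangian J \<Longrightarrow> M \<in> orbit J L0 \<Longrightarrow> M \<in> lagrangian J"
  by (auto simp: orbit_def Sp2_image_lagrangian)

lemma orbit_image: "M \<in> orbit J L0 \<Longrightarrow> g \<in> Sp2 J \<Longrightarrow> g ` M \<in> orbit J L0"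
  unfolding orbit_def
  by (auto simp: image_image intro!: image_eqI[OF _ Sp2_compose])

lemma orbit_transitive:
  assumes "M \<in> orbit J L0" "W \<in> orbit J L0"
  obtains k where "k \<in> Sp2 J" "W = k ` M"
proof -
  obtain g k where gk: "g \<in> Sp2 J" "M = g ` L0" "k \<in> Sp2 J" "W = k ` L0"
    using assms by (auto simp: orbit_def)
  obtain h where h: "h \<in> Sp2 J" "\<And>x. g (h x) = x" "\<And>x. h (g x) = x" using Sp2_inverse[OF gk(1)] by blast
  \<comment> \<open>the element \<open>k g\<^sup>-\<^sup>1\<close> takes \<open>M = g ` L0\<close> to \<open>W = k ` L0\<close>\<close>
  have "W = (k o\<^sub>L h) ` M" by (simp add: gk image_image h)
  then show ?thesis using that Sp2_compose gk h by blast
qed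

definition sym_on :: "'a set \<Rightarrow> ('a \<Rightarrow>\<^sub>L 'a) \<Rightarrow> bool" where
  "sym_on M x \<longleftrightarrow> proj M o\<^sub>L x o\<^sub>L proj M = x \<and> adj x = x"

lemma B2s_iff: "a \<in> B2s M \<longleftrightarrow> sym_on M (hs_op a)"
  by (simp add: B2s_def sym_on_def)

text \<open>The identity \<open>x J x = 0\<close>, which holds as \<open>J\<close> maps \<open>M\<close> to its orthogonal complement, makes most of the
  computations below collapse.\<close>

lemma sym_onD:
  assumes M: "M \<in> lagrangian J" and x: "sym_on M x"
  shows "proj M (x u) = x u" "x (proj M u) = x u" "x (J (x u)) = 0" "x u \<in> M"
    "x u \<bullet> v = u \<bullet> x v"
proof -
  note MD = lagrangianD[OF M]
  have PP: "proj M (proj M v) = proj M v" for v using MD by (simp add: proj_id proj_works)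
  have x': "x v = proj M (x (proj M v))" for v
  proof -
    have "proj M o\<^sub>L x o\<^sub>L proj M = x" using x by (simp add: sym_on_def)
    from arg_cong[OF this, of "\<lambda>A. blinfun_apply A v"] show ?thesis by simp
  qed
  show 1: "proj M (x u) = x u" and 2: "x (proj M v) = x v" for u v
    using x'[of u] x'[of v] PP[of v] x'[of "proj M v"] PP by (metis)+
  have "proj M (J (x u)) = 0" by (simp add: proj_J[OF M] 1)
  then show "x (J (x u)) = 0" using 2[of "J (x u)"] by (simp add: blinfun.bilinear_simps)
  show "x u \<in> M" using 1[of u] proj_works(1)[OF MD(1,2), of "x u"] by simp
  show "x u \<bullet> v = u \<bullet> x v" using x by (simp add: adj_works sym_on_def)
qed

text \<open>The point with coordinate \<open>x\<close> in the chart \<open>\<phi>\<^sub>M\<close>: since \<open>x = J T\<close>, it is the graph of \<open>T = - J x\<close>.\<close>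

definition lag_graph :: "'a set \<Rightarrow> ('a \<Rightarrow>\<^sub>L 'a) \<Rightarrow> 'a set" where
  "lag_graph M x = (\<lambda>v. v - J (x v)) ` M"

lemma graph_op_eq:
  assumes W: "subspace W" "closed W" and T: "proj (W\<^sup>\<bottom>) o\<^sub>L T o\<^sub>L proj W = T"
    and V: "V = {v + T v | v. v \<in> W}"
  shows "graph_op W V = T"
  unfolding graph_op_def
proof (rule the_equality)
  have range: "S u \<in> W\<^sup>\<bottom>" "S (proj W u) = S u" if "proj (W\<^sup>\<bottom>) o\<^sub>L S o\<^sub>L proj W = S" for S u
  proof -
    have S: "S v = proj (W\<^sup>\<bottom>) (S (proj W v))" for v
      using arg_cong[OF that, of "\<lambda>A. blinfun_apply A v"] by simp
    show "S u \<in> W\<^sup>\<bottom>" by (subst S) (intro proj_works subspace_orthogonal_comp closed_orthogonal_comp)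
    have "S (proj W u) = proj (W\<^sup>\<bottom>) (S (proj W (proj W u)))" by (rule S)
    also have "proj W (proj W u) = proj W u" using W by (simp add: proj_id proj_works)
    also have "proj (W\<^sup>\<bottom>) (S (proj W u)) = S u" by (rule S[symmetric])
    finally show "S (proj W u) = S u" .
  qed
  show "proj (W\<^sup>\<bottom>) o\<^sub>L T o\<^sub>L proj W = T \<and> V = {v + T v | v. v \<in> W}" using T V by simp
  fix T' assume T': "proj (W\<^sup>\<bottom>) o\<^sub>L T' o\<^sub>L proj W = T' \<and> V = {v + T' v | v. v \<in> W}"
  show "T' = T"
  proof (rule blinfun_eqI)
    fix u
    let ?v = "proj W u"
    have v: "?v \<in> W" using W by (rule proj_works)
    then have "?v + T' ?v \<in> V" using T' by blast
    then obtain v' where v': "v' \<in> W" "?v + T' ?v = v' + T v'" using V by blast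
    have "proj W (?v + T' ?v) = ?v" "proj W (v' + T v') = v'"
      using v v'(1) range(1)[OF T] range(1)[OF conjunct1[OF T']] W
      by (simp_all add: blinfun.bilinear_simps proj_id proj_perp)
    then have "v' = ?v" using v'(2) by simp
    then have "T' ?v = T ?v" using v' by simp
    then show "T' u = T u" using range(2)[OF T] range(2)[OF conjunct1[OF T']] by simp
  qed
qed

text \<open>As \<open>(J x)\<^sup>2 = 0\<close>, the inverse of the shear \<open>1 - J x\<close> is \<open>1 + J x\<close>. The shear carries \<open>M\<close> to the point
  with coordinate \<open>x\<close>, which is why every \<open>x\<close> in \<open>B2s M\<close> is the coordinate of a point of the orbit.\<close>

lemma shear_Sp2:
  assumes M: "M \<in> lagrangian J" and a: "a \<in> B2s M"
  shows "id_blinfun - (J o\<^sub>L hs_op a) \<in> Sp2 J"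
proof -
  let ?x = "hs_op a"
  note x = sym_onD[OF M a[unfolded B2s_iff]]
  have ax: "adj ?x = ?x" using a by (simp add: B2s_def)
  have "\<exists>h. (id_blinfun - (J o\<^sub>L ?x)) o\<^sub>L h = id_blinfun \<and> h o\<^sub>L (id_blinfun - (J o\<^sub>L ?x)) = id_blinfun"
    by (intro exI[of _ "id_blinfun + (J o\<^sub>L ?x)"] conjI blinfun_eqI)
      (simp_all add: blinfun.bilinear_simps x)
  moreover have "adj (id_blinfun - (J o\<^sub>L ?x)) o\<^sub>L J o\<^sub>L (id_blinfun - (J o\<^sub>L ?x)) = J"
    by (rule blinfun_eqI) (simp add: blinfun.bilinear_simps x J_adj ax)
  moreover have "hilbert_schmidt (id_blinfun - (J o\<^sub>L ?x) - id_blinfun)"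
    by (simp add: hilbert_schmidt_uminus hs_compose_left hilbert_schmidt_hs_op)
  ultimately show ?thesis by (simp add: Sp2_def Sp_def)
qed

lemma lag_graph_orbit:
  assumes "M \<in> lagrangian J" "M \<in> orbit J L0" "a \<in> B2s M"
  shows "lag_graph M (hs_op a) \<in> orbit J L0"
proof -
  have "lag_graph M (hs_op a) = (id_blinfun - (J o\<^sub>L hs_op a)) ` M"
    by (simp add: lag_graph_def blinfun.bilinear_simps)
  then show ?thesis using orbit_image[OF assms(2) shear_Sp2[OF assms(1,3)]] by simp
qed

lemma lag_graph_chart_dom:
  assumes M: "M \<in> lagrangian J" "M \<in> orbit J L0" and L0: "L0 \<in> lagrangian J" and a: "a \<in> B2s M"
  shows "lag_graph M (hs_op a) \<in> chart_dom J L0 M"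
proof -
  let ?x = "hs_op a" and ?W = "lag_graph M (hs_op a)"
  note x = sym_onD[OF M(1) a[unfolded B2s_iff]] and MD = lagrangianD[OF M(1)]
  have "?W \<in> orbit J L0" by (rule lag_graph_orbit[OF M a])
  then have "?W \<in> lagrangian J" "?W \<in> orbit J L0" by (auto intro: orbit_lagrangian[OF L0])
  moreover have "?W \<inter> M\<^sup>\<bottom> = {0}"
  proof -
    have "v - J (?x v) = 0" if v: "v \<in> M" "v - J (?x v) \<in> M\<^sup>\<bottom>" for v
    proof -
      have "proj M (v - J (?x v)) = 0" using MD v by (intro proj_perp)
      then have "v = 0"
        using MD v by (simp add: blinfun.bilinear_simps proj_id proj_J[OF M(1)] x)
      then show ?thesis by (simp add: blinfun.bilinear_simps)
    qed
    moreover have "0 \<in> ?W" unfolding lag_graph_def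
      using subspace_0[OF MD(1)] by (intro image_eqI[of _ _ 0]) (auto simp: blinfun.bilinear_simps)
    ultimately show ?thesis using subspace_0[OF subspace_orthogonal_comp] by (auto simp: lag_graph_def)
  qed
  moreover have "\<exists>a\<in>?W. \<exists>b\<in>M\<^sup>\<bottom>. z = a + b" for z
  proof (intro bexI)
    show "z = (proj M z - J (?x (proj M z))) + ((z - proj M z) + J (?x z))" by (simp add: x)
    show "(z - proj M z) + J (?x z) \<in> M\<^sup>\<bottom>"
      by (intro subspace_add subspace_orthogonal_comp MD x proj_works)
    show "proj M z - J (?x (proj M z)) \<in> ?W"
      unfolding lag_graph_def using MD by (intro imageI proj_works)
  qed
  ultimately show ?thesis by (auto simp: chart_dom_def Omega_def)
qed

lemma graph_op_lag_graph:
  assumes M: "M \<in> lagrangian J" and x: "sym_on M x"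
  shows "graph_op M (lag_graph M x) = - (J o\<^sub>L x)"
proof (rule graph_op_eq)
  note xD = sym_onD[OF M x] and MD = lagrangianD[OF M]
  show "subspace M" "closed M" by (rule MD)+
  show "proj (M\<^sup>\<bottom>) o\<^sub>L - (J o\<^sub>L x) o\<^sub>L proj M = - (J o\<^sub>L x)"
    by (rule blinfun_eqI) (simp add: proj_orthogonal_comp MD blinfun.bilinear_simps xD proj_J[OF M])
  show "lag_graph M x = {v + (- (J o\<^sub>L x)) v |v. v \<in> M}"
    by (auto simp: lag_graph_def blinfun.bilinear_simps)
qed

lemma chart_lag_graph:
  assumes M: "M \<in> lagrangian J" and a: "a \<in> B2s M"
  shows "chart J M (lag_graph M (hs_op a)) = a"
proof -
  have "J o\<^sub>L - (J o\<^sub>L hs_op a) = hs_op a"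
    by (rule blinfun_eqI) (simp add: blinfun.bilinear_simps)
  then show ?thesis
    by (simp add: chart_def graph_op_lag_graph[OF M a[unfolded B2s_iff]] hs_op_inverse)
qed

text \<open>Transversality gives a linear map \<open>t\<close> with graph \<open>W\<close>. Since \<open>W\<close> is isotropic, \<open>J t\<close> is symmetric and
  thus bounded by \<open>hellinger_toeplitz\<close>.\<close>

lemma transversal_is_graph:
  assumes M: "M \<in> lagrangian J" and W: "W \<in> Omega J M"
  obtains x where "sym_on M x" "W = lag_graph M x"
proof -
  note MD = lagrangianD[OF M]
  have WL: "W \<in> lagrangian J" and tr: "W \<inter> M\<^sup>\<bottom> = {0}"
    and dec: "\<And>z. \<exists>a\<in>W. \<exists>b\<in>M\<^sup>\<bottom>. z = a + b" using W by (auto simp: Omega_def)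
  note WD = lagrangianD[OF WL]
  have Msub: "subspace (M\<^sup>\<bottom>)" by (rule subspace_orthogonal_comp)
  have "\<exists>b. b \<in> M\<^sup>\<bottom> \<and> proj M u + b \<in> W" for u
  proof -
    obtain a b where "a \<in> W" "b \<in> M\<^sup>\<bottom>" "proj M u = a + b" using dec by blast
    then show ?thesis using Msub by (intro exI[of _ "- b"]) (simp add: subspace_neg)
  qed
  then obtain t where t: "\<And>u. t u \<in> M\<^sup>\<bottom>" "\<And>u. proj M u + t u \<in> W" by metis
  have t_unique: "t u = b" if "b \<in> M\<^sup>\<bottom>" "proj M u + b \<in> W" for u b
  proof -
    have "(proj M u + t u) - (proj M u + b) \<in> W" using that t WD(1) by (intro subspace_diff)
    moreover have "t u - b \<in> M\<^sup>\<bottom>" using that t Msub by (intro subspace_diff)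
    ultimately have "t u - b \<in> W \<inter> M\<^sup>\<bottom>" by simp
    then show ?thesis using tr by simp
  qed
  have PM: "proj M u \<in> M" for u using MD by (intro proj_works)
  have JtM: "J (t u) \<in> M" for u using t MD by blast
  have sym: "J (t u) \<bullet> v = u \<bullet> J (t v)" for u v
  proof -
    have 0: "J (proj M u + t u) \<bullet> (proj M v + t v) = 0"
      using WD(3)[OF t(2)[of u]] t(2)[of v] by (rule orthogonal_compD)
    have 1: "J (proj M u) \<bullet> proj M v = 0" "J (t u) \<bullet> t v = 0"
      using orthogonal_compD[OF MD(3)[OF PM] PM] orthogonal_compD[OF t(1)[of v] JtM[of u]]
      by (auto simp: inner_commute)
    have 2: "(v - proj M v) \<bullet> J (t u) = 0" "(u - proj M u) \<bullet> J (t v) = 0"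
      using MD by (auto intro!: orthogonal_compD[OF proj_works(2) JtM])
    have "J (t u) \<bullet> v = J (t u) \<bullet> proj M v" using 2(1) by (simp add: inner_diff_left inner_commute[of "J (t u)"])
    also have "\<dots> = - (J (proj M u) \<bullet> t v)"
      using 0 1 by (simp add: blinfun.bilinear_simps inner_add_left inner_add_right)
    also have "\<dots> = proj M u \<bullet> J (t v)" by (simp add: inner_J)
    also have "\<dots> = u \<bullet> J (t v)" using 2(2) by (simp add: inner_diff_left)
    finally show ?thesis .
  qed
  define x where "x = Blinfun (\<lambda>u. J (t u))"
  have x: "x u = J (t u)" for u
    unfolding x_def by (rule bounded_linear_Blinfun_apply[THEN fun_cong]) (rule hellinger_toeplitz[OF sym])
  have tP: "t (proj M u) = t u" for u
    using t MD by (intro t_unique) (auto simp: proj_id proj_works)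
  have "sym_on M x" unfolding sym_on_def
    by (auto intro!: blinfun_eqI adj_eqI simp: x sym tP proj_id[OF MD(1,2) JtM])
  moreover have "W = lag_graph M x"
  proof
    show "lag_graph M x \<subseteq> W"
    proof
      fix w assume "w \<in> lag_graph M x"
      then obtain v where v: "v \<in> M" "w = v + t v" by (auto simp: lag_graph_def x)
      then show "w \<in> W" using t(2)[of v] MD by (simp add: proj_id)
    qed
    show "W \<subseteq> lag_graph M x"
    proof
      fix w assume w: "w \<in> W"
      have "t w = w - proj M w" using w MD by (intro t_unique) (auto simp: proj_works)
      then have "w = proj M w - J (x (proj M w))" by (simp add: x tP)
      then show "w \<in> lag_graph M x" unfolding lag_graph_def using PM by blast
    qed
  qed
  ultimately show ?thesis using that by blast
qed

text \<open>The coordinate of a point \<open>W = k ` M\<close> of the orbit is Hilbert--Schmidt because it can be solved for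
  in terms of \<open>k - 1\<close>: comparing the component of \<open>k u\<close> in \<open>M\<^sup>\<bottom>\<close> with its component in \<open>M\<close>, for \<open>u\<close> in \<open>M\<close>,
  gives \<open>x = J (1 - P) (k - 1) P - x (k - 1) P\<close>.\<close>

lemma chart_domD:
  assumes L0: "L0 \<in> lagrangian J" and Mo: "M \<in> orbit J L0" and W: "W \<in> chart_dom J L0 M"
  shows "chart J M W \<in> B2s M" "W = lag_graph M (hs_op (chart J M W))"
proof -
  have M: "M \<in> lagrangian J" using orbit_lagrangian[OF L0 Mo] .
  note MD = lagrangianD[OF M]
  obtain x where x: "sym_on M x" and Wx: "W = lag_graph M x"
    using transversal_is_graph[OF M] W unfolding chart_dom_def by blast
  obtain k where k: "k \<in> Sp2 J" "W = k ` M"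
    using W by (auto simp: chart_dom_def elim: orbit_transitive[OF Mo])
  note xD = sym_onD[OF M x]
  let ?P = "proj M" and ?k = "k - id_blinfun"
  have "k (?P u) - ?P (k (?P u)) = - J (x (k (?P u)))" for u
  proof -
    have "k (?P u) \<in> W" using k MD proj_works by blast
    then obtain v where v: "v \<in> M" "k (?P u) = v - J (x v)" using Wx by (auto simp: lag_graph_def)
    have "?P (v - J (x v)) = v" "x (v - J (x v)) = x v"
      using v MD by (simp_all add: blinfun.bilinear_simps proj_id proj_J[OF M] xD)
    then show ?thesis by (simp add: v)
  qed
  then have "J (k (?P u)) - J (?P (k (?P u))) = x (k (?P u))" for u
    by (metis JJ add.inverse_inverse blinfun.diff_right blinfun.minus_right)
  then have "x = (J o\<^sub>L (id_blinfun - ?P) o\<^sub>L (?k o\<^sub>L ?P)) - (x o\<^sub>L (?k o\<^sub>L ?P))"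
    using MD by (intro blinfun_eqI) (simp add: blinfun.bilinear_simps xD proj_id proj_works)
  moreover have kP: "hilbert_schmidt (?k o\<^sub>L ?P)"
    using k(1) by (intro hs_compose_right) (simp add: Sp2_def)
  then have "hilbert_schmidt ((J o\<^sub>L (id_blinfun - ?P) o\<^sub>L (?k o\<^sub>L ?P)) - (x o\<^sub>L (?k o\<^sub>L ?P)))"
    by (intro hilbert_schmidt_diff hs_compose_left[OF kP])
  ultimately have hs: "hilbert_schmidt x" by simp
  then have "Hs x \<in> B2s M" using x by (simp add: B2s_iff hs_op_Hs)
  moreover have "chart J M W = Hs x" using \<open>Hs x \<in> B2s M\<close>
     chart_lag_graph[OF M, of "Hs x"] by (simp add: hs_op_Hs hs Wx)
  ultimately show "chart J M W \<in> B2s M" "W = lag_graph M (hs_op (chart J M W))"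
    using Wx by (auto simp: hs_op_Hs hs)
qed

lemma chart_inv_eq:
  assumes L0: "L0 \<in> lagrangian J" and M: "M \<in> orbit J L0" and a: "a \<in> B2s M"
  shows "chart_inv J L0 M a = lag_graph M (hs_op a)"
  unfolding chart_inv_def
proof (rule the_inv_into_f_eq)
  have lagM: "M \<in> lagrangian J" using orbit_lagrangian[OF L0 M] .
  show "inj_on (chart J M) (chart_dom J L0 M)"
    using chart_domD(2)[OF L0 M] by (metis inj_onI)
  show "chart J M (lag_graph M (hs_op a)) = a" by (rule chart_lag_graph[OF lagM a])
  show "lag_graph M (hs_op a) \<in> chart_dom J L0 M" by (rule lag_graph_chart_dom[OF lagM M L0 a])
qed

end


section \<open>Derivatives within a subspace\<close>

lemma has_derivative_quadratic_error:
  assumes F: "bounded_linear F" and e: "e > 0"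
    and err: "\<And>y. y \<in> S \<Longrightarrow> norm (y - x) < e \<Longrightarrow> norm (f y - f x - F (y - x)) \<le> K * (norm (y - x))\<^sup>2"
  shows "(f has_derivative F) (at x within S)"
proof (rule has_derivativeI_sandwich[OF e F])
  fix y assume y: "y \<in> S" "y \<noteq> x" "dist y x < e"
  then have "norm (f y - f x - F (y - x)) \<le> (K * norm (y - x)) * norm (y - x)"
    using err[of y] by (simp add: dist_norm power2_eq_square mult.assoc)
  then show "norm (f y - f x - F (y - x)) / norm (y - x) \<le> K * norm (y - x)"
    using y by (simp add: pos_divide_le_eq)
next
  have "((\<lambda>y. K * norm (y - x)) \<longlongrightarrow> K * norm (x - x)) (at x within S)"
    by (intro tendsto_intros)
  then show "((\<lambda>y. K * norm (y - x)) \<longlongrightarrow> 0) (at x within S)" by simp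
qed

text \<open>A derivative within a subspace is only unique on the subspace. Restriction to lines reduces
  this to the uniqueness of derivatives of curves.\<close>

lemma has_derivative_within_subspace_line:
  assumes f: "(f has_derivative D) (at x within B)" and B: "subspace B" "x \<in> B" "h \<in> B"
  shows "((\<lambda>s. f (x + s *\<^sub>R h)) has_vector_derivative D h) (at 0)"
proof -
  have "((\<lambda>s. x + s *\<^sub>R h) has_derivative (\<lambda>s. s *\<^sub>R h)) (at 0)"
    by (auto intro!: derivative_eq_intros)
  moreover have "(f has_derivative D) (at (x + 0 *\<^sub>R h) within range (\<lambda>s. x + s *\<^sub>R h))"
    using B by (auto intro!: has_derivative_subset[OF f] simp: subspace_add subspace_scale)
  ultimately have "((\<lambda>s. f (x + s *\<^sub>R h)) has_derivative (\<lambda>s. D (s *\<^sub>R h))) (at 0)"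
    by (rule has_derivative_in_compose)
  then show ?thesis
    by (simp add: has_vector_derivative_def linear_scale[OF has_derivative_linear[OF f]])
qed

section \<open>The ambient metric in a chart\<close>

context complex_structure
begin

lemma proj_lagrangian:
  assumes "M \<in> lagrangian J"
  shows "proj M u \<in> M" "u \<in> M \<Longrightarrow> proj M u = u" "proj M (proj M u) = proj M u"
    "proj M u \<bullet> v = u \<bullet> proj M v" "adj (proj M) = proj M"
proof -
  note MD = lagrangianD[OF assms]
  show 1: "proj M u \<in> M" "adj (proj M) = proj M" using MD by (simp_all add: proj_works adj_proj)
  show "u \<in> M \<Longrightarrow> proj M u = u" "proj M (proj M u) = proj M u"
    using MD 1 by (simp_all add: proj_id)
  show "proj M u \<bullet> v = u \<bullet> proj M v" by (simp add: adj_works 1)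
qed

lemma subspace_B2s: "subspace (B2s (M :: 'a set))"
proof -
  have "proj M o\<^sub>L 0 o\<^sub>L proj M = 0" "adj (0 :: 'a \<Rightarrow>\<^sub>L 'a) = 0"
    using adj_simps(5)[of 0 "0 :: 'a \<Rightarrow>\<^sub>L 'a"] by simp_all
  moreover have "proj M o\<^sub>L (A + B) o\<^sub>L proj M = (proj M o\<^sub>L A o\<^sub>L proj M) + (proj M o\<^sub>L B o\<^sub>L proj M)" for A B
    by (rule blinfun_eqI) (simp add: blinfun.bilinear_simps)
  moreover have "proj M o\<^sub>L (r *\<^sub>R A) o\<^sub>L proj M = r *\<^sub>R (proj M o\<^sub>L A o\<^sub>L proj M)" for r A
    by (rule blinfun_eqI) (simp add: blinfun.bilinear_simps)
  ultimately show ?thesis by (simp add: subspace_def B2s_def hs_op_simps)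
qed

text \<open>The inverse of \<open>1 + x y\<close>, which occurs when points with coordinate \<open>y\<close> are read in the chart
  centred at the point with coordinate \<open>x\<close>. For \<open>y\<close> near \<open>x\<close> it exists since \<open>1 + x\<^sup>2\<close> is coercive. The norm bound
  is included so that it holds uniformly in \<open>y\<close>.\<close>

definition cross_inverse :: "('a \<Rightarrow>\<^sub>L 'a) \<Rightarrow> ('a \<Rightarrow>\<^sub>L 'a) \<Rightarrow> ('a \<Rightarrow>\<^sub>L 'a)" where
  "cross_inverse x y = (SOME R. (id_blinfun + (x o\<^sub>L y)) o\<^sub>L R = id_blinfun \<and>
     R o\<^sub>L (id_blinfun + (x o\<^sub>L y)) = id_blinfun \<and> norm R \<le> 2)"

lemma cross_inverse:
  assumes M: "M \<in> lagrangian J" and x: "sym_on M x" and y: "sym_on M y"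
    and near: "norm (y - x) * norm x \<le> 1/2"
  shows "cross_inverse x y u + x (y (cross_inverse x y u)) = u"
    "cross_inverse x y u + cross_inverse x y (x (y u)) = u"
    "norm (cross_inverse x y) \<le> 2"
proof -
  note xD = sym_onD[OF M x]
  have coercive: "1/2 * (norm u)\<^sup>2 \<le> (id_blinfun + (x o\<^sub>L y)) u \<bullet> u" for u
  proof -
    have "\<bar>(y - x) u \<bullet> x u\<bar> \<le> norm ((y - x) u) * norm (x u)" by (rule Cauchy_Schwarz_ineq2)
    also have "\<dots> \<le> (norm (y - x) * norm u) * (norm x * norm u)"
      by (intro mult_mono norm_blinfun) auto
    also have "\<dots> = (norm (y - x) * norm x) * (norm u)\<^sup>2" by (simp add: power2_eq_square)
    also have "\<dots> \<le> 1/2 * (norm u)\<^sup>2" using near by (intro mult_right_mono) auto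
    finally have "- ((y - x) u \<bullet> x u) \<le> 1/2 * (norm u)\<^sup>2" by simp
    moreover have "(id_blinfun + (x o\<^sub>L y)) u \<bullet> u = (norm u)\<^sup>2 + (norm (x u))\<^sup>2 + (y - x) u \<bullet> x u"
      by (simp add: blinfun.bilinear_simps inner_add_left inner_diff_left power2_norm_eq_inner xD)
    moreover have "0 \<le> (norm (x u))\<^sup>2" by simp
    ultimately show ?thesis by linarith
  qed
  have "\<exists>R. (id_blinfun + (x o\<^sub>L y)) o\<^sub>L R = id_blinfun \<and> R o\<^sub>L (id_blinfun + (x o\<^sub>L y)) = id_blinfun
      \<and> norm R \<le> 2"
    by (rule lax_milgram[OF _ coercive]) auto
  from someI_ex[OF this] have
    "(id_blinfun + (x o\<^sub>L y)) o\<^sub>L cross_inverse x y = id_blinfun"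
    "cross_inverse x y o\<^sub>L (id_blinfun + (x o\<^sub>L y)) = id_blinfun"
    and 3: "norm (cross_inverse x y) \<le> 2"
    unfolding cross_inverse_def by blast+
  from arg_cong[OF this(1), of "\<lambda>A. blinfun_apply A u"] arg_cong[OF this(2), of "\<lambda>A. blinfun_apply A u"] 3
  show "cross_inverse x y u + x (y (cross_inverse x y u)) = u"
    "cross_inverse x y u + cross_inverse x y (x (y u)) = u"
    "norm (cross_inverse x y) \<le> 2"
    by (simp_all add: blinfun.bilinear_simps)
qed

abbreviation resolvent :: "('a \<Rightarrow>\<^sub>L 'a) \<Rightarrow> ('a \<Rightarrow>\<^sub>L 'a)" where
  "resolvent x \<equiv> cross_inverse x x"

lemma resolvent:
  assumes M: "M \<in> lagrangian J" and x: "sym_on M x"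
  shows "resolvent x u + x (x (resolvent x u)) = u" "resolvent x u + resolvent x (x (x u)) = u"
    "norm (resolvent x) \<le> 2"
    "proj M (resolvent x u) = resolvent x (proj M u)" "x (resolvent x u) = resolvent x (x u)"
    "adj (resolvent x) = resolvent x"
proof -
  note R = cross_inverse[OF M x x] and xD = sym_onD[OF M x]
  let ?S = "resolvent x"
  show R1: "?S u + x (x (?S u)) = u" and R2: "?S u + ?S (x (x u)) = u" and "norm ?S \<le> 2" for u
    using R by simp_all
  have unique: "?S w = z" if "w = z + x (x z)" for w z
    using R2[of z] by (simp add: that blinfun.bilinear_simps)
  have "proj M u = proj M (?S u) + x (x (proj M (?S u)))"
    using arg_cong[OF R1[of u], of "proj M"] by (simp add: blinfun.bilinear_simps xD)
  then show "proj M (?S u) = ?S (proj M u)" by (rule unique[symmetric])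
  have "x u = x (?S u) + x (x (x (?S u)))"
    using arg_cong[OF R1[of u], of x] by (simp add: blinfun.bilinear_simps)
  then show "x (?S u) = ?S (x u)" by (rule unique[symmetric])
  have "?S u \<bullet> v = u \<bullet> ?S v" for u v
  proof -
    have "?S u \<bullet> (?S v + x (x (?S v))) = (?S u + x (x (?S u))) \<bullet> ?S v"
      by (simp add: inner_add_left inner_add_right xD)
    then show ?thesis by (simp add: R1)
  qed
  then show "adj ?S = ?S" by (rule adj_eqI)
qed

text \<open>The frame \<open>A = P - J x\<close> parametrizes the graph by \<open>M\<close>, the coframe is its adjoint. Their product is
  \<open>A\<^sup>* A = P + x\<^sup>2\<close>, so with the resolvent \<open>S\<close> the projection onto the graph is \<open>A S A\<^sup>*\<close>.\<close>

definition lag_frame :: "'a set \<Rightarrow> ('a \<Rightarrow>\<^sub>L 'a) \<Rightarrow> ('a \<Rightarrow>\<^sub>L 'a)" where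
  "lag_frame M x = proj M - (J o\<^sub>L x)"

definition lag_coframe :: "'a set \<Rightarrow> ('a \<Rightarrow>\<^sub>L 'a) \<Rightarrow> ('a \<Rightarrow>\<^sub>L 'a)" where
  "lag_coframe M x = proj M + (x o\<^sub>L J)"

lemma frame_simps: "lag_frame M x u = proj M u - J (x u)" "lag_coframe M x u = proj M u + x (J u)"
  by (simp_all add: lag_frame_def lag_coframe_def blinfun.bilinear_simps)

lemma frame:
  assumes M: "M \<in> lagrangian J" and x: "sym_on M x"
  shows "adj (lag_frame M x) = lag_coframe M x" "adj (lag_coframe M x) = lag_frame M x"
    "lag_frame M x u \<in> lag_graph M x" "lag_coframe M x u \<in> M"
    "lag_coframe M x (lag_frame M x u) = proj M u + x (x u)"
proof -
  note xD = sym_onD[OF M x] and MD = lagrangianD[OF M] and PD = proj_lagrangian[OF M]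
  have ax: "adj x = x" using x by (simp add: sym_on_def)
  have "adj (lag_frame M x) u = lag_coframe M x u" for u
    by (simp add: lag_frame_def lag_coframe_def PD J_adj ax blinfun.bilinear_simps)
  then show 1: "adj (lag_frame M x) = lag_coframe M x" by (rule blinfun_eqI)
  show "adj (lag_coframe M x) = lag_frame M x" by (simp flip: 1)
  show "lag_frame M x u \<in> lag_graph M x"
    unfolding lag_graph_def frame_simps using PD by (intro image_eqI[of _ _ "proj M u"]) (auto simp: xD)
  show "lag_coframe M x u \<in> M" using MD PD xD by (simp add: frame_simps subspace_add)
  have "x (J (proj M u)) = x (proj M (J (proj M u)))" by (simp add: xD)
  also have "\<dots> = 0" by (simp add: proj_J[OF M] PD blinfun.bilinear_simps)
  finally show "lag_coframe M x (lag_frame M x u) = proj M u + x (x u)"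
    by (simp add: frame_simps blinfun.bilinear_simps proj_J[OF M] PD xD)
qed

lemma sym_on_J_proj:
  assumes M: "M \<in> lagrangian J" and x: "sym_on M x" and v: "v \<in> M"
  shows "x (J v) = 0" "proj M (J v) = 0"
proof -
  show "proj M (J v) = 0" by (simp add: proj_J[OF M] proj_lagrangian[OF M] v)
  then show "x (J v) = 0" using sym_onD(2)[OF M x, of "J v"] by (simp add: blinfun.bilinear_simps)
qed

lemma coframe_frame_resolvent:
  assumes M: "M \<in> lagrangian J" and x: "sym_on M x" and u: "u \<in> M"
  shows "lag_coframe M x (lag_frame M x (resolvent x u)) = u"
  using resolvent(1)[OF M x, of u] u
  by (simp add: frame[OF M x] resolvent[OF M x] proj_lagrangian[OF M])

lemma proj_lag_graph:
  assumes M: "M \<in> lagrangian J" and x: "sym_on M x" and W: "lag_graph M x \<in> lagrangian J"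
  shows "proj (lag_graph M x) u = lag_frame M x (resolvent x (lag_coframe M x u))"
proof (rule proj_eqI)
  let ?A = "lag_frame M x" and ?B = "lag_coframe M x" and ?S = "resolvent x"
  show "subspace (lag_graph M x)" "closed (lag_graph M x)" using lagrangianD[OF W] by auto
  show "?A (?S (?B u)) \<in> lag_graph M x" by (rule frame[OF M x])
  show "u - ?A (?S (?B u)) \<in> (lag_graph M x)\<^sup>\<bottom>"
  proof (rule orthogonal_compI)
    fix w assume "w \<in> lag_graph M x"
    then obtain v where v: "v \<in> M" "w = v - J (x v)" by (auto simp: lag_graph_def)
    then have w: "w = ?A v" by (simp add: frame_simps proj_lagrangian[OF M])
    have "(u - ?A (?S (?B u))) \<bullet> ?A v = ?B (u - ?A (?S (?B u))) \<bullet> v"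
      by (simp add: adj_works frame[OF M x])
    also have "?B (u - ?A (?S (?B u))) = 0"
      using coframe_frame_resolvent[OF M x frame(4)[OF M x]] by (simp add: blinfun.diff_right)
    finally show "(u - ?A (?S (?B u))) \<bullet> w = 0" by (simp add: w)
  qed
qed

text \<open>With \<open>A\<close>, \<open>S\<close> as above and \<open>R\<close> the inverse of \<open>1 + x y\<close>, the transition map is
  \<open>y \<mapsto> A S (y - x) R A\<^sup>*\<close>. The coframe applied to \<open>l - J y l\<close> is \<open>(1 + x y) l\<close>, so \<open>R\<close> recovers \<open>l\<close>
  from the component of this point of the second graph along the first.\<close>

lemma chart_transition:
  assumes M: "M \<in> lagrangian J" and a: "a \<in> B2s M" and b: "b \<in> B2s M"
    and W: "lag_graph M (hs_op a) \<in> lagrangian J"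
    and near: "norm (hs_op b - hs_op a) * norm (hs_op a) \<le> 1/2"
  shows "chart J (lag_graph M (hs_op a)) (lag_graph M (hs_op b)) =
    sandwich (lag_frame M (hs_op a) o\<^sub>L resolvent (hs_op a))
      (cross_inverse (hs_op a) (hs_op b) o\<^sub>L lag_coframe M (hs_op a)) (b - a)"
proof -
  let ?x = "hs_op a" and ?y = "hs_op b"
  let ?A = "lag_frame M ?x" and ?B = "lag_coframe M ?x" and ?S = "resolvent ?x" and ?R = "cross_inverse ?x ?y"
  let ?W = "lag_graph M ?x" and ?V = "lag_graph M ?y"
  have x: "sym_on M ?x" and y: "sym_on M ?y" using a b by (auto simp: B2s_iff)
  note xD = sym_onD[OF M x] and yD = sym_onD[OF M y] and SD = resolvent[OF M x]
    and RD = cross_inverse[OF M x y near] and PD = proj_lagrangian[OF M] and FD = frame[OF M x]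
    and MD = lagrangianD[OF M] and WD = lagrangianD[OF W] and PW = proj_lag_graph[OF M x W]
  define Z where "Z = ?A o\<^sub>L ?S o\<^sub>L (?y - ?x) o\<^sub>L (?R o\<^sub>L ?B)"
  define T where "T = - (J o\<^sub>L Z)"
  have ZW: "Z u \<in> ?W" for u unfolding Z_def by (simp add: FD)
  have ZP: "Z (proj ?W u) = Z u" for u
    unfolding Z_def by (simp add: PW coframe_frame_resolvent[OF M x FD(4)])
  have "proj (?W\<^sup>\<bottom>) o\<^sub>L T o\<^sub>L proj ?W = T"
  proof (rule blinfun_eqI)
    fix u
    have "proj ?W (J (Z u)) = 0" by (simp add: proj_J[OF W] proj_lagrangian[OF W] ZW)
    then show "(proj (?W\<^sup>\<bottom>) o\<^sub>L T o\<^sub>L proj ?W) u = T u"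
      by (simp add: T_def ZP proj_orthogonal_comp[OF WD(1,2)] blinfun.bilinear_simps)
  qed
  moreover have "?V = {w + T w |w. w \<in> ?W}"
  proof -
    \<comment> \<open>every \<open>l\<close> in \<open>M\<close> parametrizes a point of both graphs, related by \<open>T\<close>\<close>
    have key: "?A (?S q) + T (?A (?S q)) = l - J (?y l)"
      if l: "l \<in> M" and q: "q = l + ?x (?y l)" for l q
    proof -
      have qM: "q \<in> M" using MD l xD by (simp add: q subspace_add)
      have "?R q = l" using RD(2)[of l] by (simp add: q blinfun.bilinear_simps)
      define s where "s = ?S q"
      define s' where "s' = ?S (?y l - ?x l)"
      have PS: "proj M (?S u) = ?S u" if "u \<in> M" for u using that by (simp add: SD PD)
      have sM: "proj M s = s" "proj M s' = s'"
        unfolding s_def s'_def using qM MD xD yD by (auto intro!: PS subspace_diff)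
      have "T (?A s) = - J (?A s')"
        using \<open>?R q = l\<close>
        by (simp add: s_def s'_def T_def Z_def coframe_frame_resolvent[OF M x qM] blinfun.bilinear_simps)
      also have "\<dots> = - J s' - ?x s'" by (simp add: frame_simps sM blinfun.bilinear_simps)
      finally have "?A s + T (?A s) = s - J (?x s) - J s' - ?x s'" by (simp add: frame_simps sM)
      moreover have "s = l + ?x s'"
        using SD(2)[of l] by (simp add: s_def s'_def SD(5) q blinfun.bilinear_simps algebra_simps)
      moreover have "J s' = J (?y l) - J (?x s)"
      proof -
        have "s' = ?y l - ?x s"
          using SD(2)[of "?y l"] by (simp add: s_def s'_def SD(5) q blinfun.bilinear_simps algebra_simps)
        then show ?thesis by (simp add: blinfun.bilinear_simps)
      qed
      ultimately show ?thesis unfolding s_def by simp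
    qed
    show ?thesis
    proof
      show "?V \<subseteq> {w + T w |w. w \<in> ?W}"
      proof
        fix v assume "v \<in> ?V"
        then obtain l where "l \<in> M" "v = l - J (?y l)" by (auto simp: lag_graph_def)
        then show "v \<in> {w + T w |w. w \<in> ?W}" using key[OF _ refl, of l] FD(3) by (metis (mono_tags, lifting) mem_Collect_eq)
      qed
      show "{w + T w |w. w \<in> ?W} \<subseteq> ?V"
      proof clarify
        fix w assume w: "w \<in> ?W"
        define l where "l = ?R (?B w)"
        have q: "?B w = l + ?x (?y l)" using RD(1)[of "?B w"] by (simp add: l_def)
        have "l = ?B w - ?x (?y l)" using q by simp
        then have l: "l \<in> M" using MD FD xD by (metis subspace_diff)
        have "w = ?A (?S (?B w))" using PW[of w] proj_lagrangian[OF W] w by simp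
        then have "w + T w = l - J (?y l)" using key[OF l q] by simp
        then show "w + T w \<in> ?V" using l by (auto simp: lag_graph_def)
      qed
    qed
  qed
  ultimately have "graph_op ?W ?V = T" by (intro graph_op_eq WD)
  moreover have "J o\<^sub>L T = Z" by (rule blinfun_eqI) (simp add: T_def blinfun.bilinear_simps)
  ultimately show ?thesis by (simp add: chart_def Z_def sandwich_def hs_op_simps)
qed

text \<open>The differential at \<open>a\<close> of the transition map from \<open>\<phi>\<^sub>M\<close> to the chart centred at the point with
  coordinate \<open>a\<close>.\<close>

definition pushforward :: "'a set \<Rightarrow> 'a hs \<Rightarrow> 'a hs \<Rightarrow> 'a hs" where
  "pushforward M a = sandwich (lag_frame M (hs_op a) o\<^sub>L resolvent (hs_op a))
      (resolvent (hs_op a) o\<^sub>L lag_coframe M (hs_op a))"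

text \<open>The transition map is linear in \<open>y - x\<close> up to the factor \<open>R\<close>, and \<open>R - S = R x (x - y) S\<close> is of first
  order by the resolvent identity, so the error is quadratic.\<close>

lemma chart_transition_has_derivative:
  assumes M: "M \<in> lagrangian J" and a: "a \<in> B2s M" and W: "lag_graph M (hs_op a) \<in> lagrangian J"
  shows "((\<lambda>b. chart J (lag_graph M (hs_op a)) (lag_graph M (hs_op b))) has_derivative pushforward M a)
    (at a within B2s M)"
proof -
  let ?x = "hs_op a"
  let ?A = "lag_frame M ?x" and ?B = "lag_coframe M ?x" and ?S = "resolvent ?x"
  have x: "sym_on M ?x" using a by (simp add: B2s_iff)
  note SD = resolvent[OF M x]
  \<comment> \<open>within this radius \<open>1 + x y\<close> is coercive with constant \<open>1/2\<close>\<close>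
  have e: "0 < 1 / (2 * (norm ?x + 1))" by (simp add: add_nonneg_pos)
  show ?thesis
  proof (rule has_derivative_quadratic_error[OF _ e])
    show "bounded_linear (pushforward M a)" unfolding pushforward_def by (rule bounded_linear_sandwich)
    fix b assume b: "b \<in> B2s M" "norm (b - a) < 1 / (2 * (norm ?x + 1))"
    let ?y = "hs_op b" and ?R = "cross_inverse ?x (hs_op b)"
    have y: "sym_on M ?y" using b by (simp add: B2s_iff)
    have yx: "norm (?y - ?x) \<le> norm (b - a)" using norm_hs_op_le[of "b - a"] by (simp add: hs_op_simps)
    have "norm (?y - ?x) * norm ?x \<le> norm (b - a) * (norm ?x + 1)"
      using yx by (intro mult_mono) auto
    also have "\<dots> \<le> 1/2"
    proof -
      have "norm (b - a) * (2 * (norm ?x + 1)) < 1"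
        using b(2) by (subst (asm) pos_less_divide_eq) (auto simp: add_nonneg_pos)
      then show ?thesis by (simp add: algebra_simps)
    qed
    finally have near: "norm (?y - ?x) * norm ?x \<le> 1/2" .
    note RD = cross_inverse[OF M x y near]
    have "norm (?x - ?x) * norm ?x \<le> 1/2" by simp
    from chart_transition[OF M a a W this]
    have at_a: "chart J (lag_graph M ?x) (lag_graph M ?x) = 0"
      using bounded_linear.linear[OF bounded_linear_sandwich, THEN linear_0] by simp
    have diff: "?R - ?S = ?R o\<^sub>L ?x o\<^sub>L (?x - ?y) o\<^sub>L ?S"
    proof (rule blinfun_eqI)
      fix u
      have "?R u = ?R (?S u + ?x (?x (?S u)))" by (simp add: SD(1))
      then show "(?R - ?S) u = (?R o\<^sub>L ?x o\<^sub>L (?x - ?y) o\<^sub>L ?S) u"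
        using RD(2)[of "?S u"] by (simp add: blinfun.bilinear_simps algebra_simps)
    qed
    have "norm (?R - ?S) \<le> norm (?R o\<^sub>L ?x o\<^sub>L (?x - ?y)) * norm ?S"
      unfolding diff by (rule norm_blinfun_compose)
    also have "\<dots> \<le> (norm (?R o\<^sub>L ?x) * norm (?x - ?y)) * norm ?S"
      by (intro mult_right_mono norm_blinfun_compose) auto
    also have "\<dots> \<le> ((norm ?R * norm ?x) * norm (?x - ?y)) * norm ?S"
      by (intro mult_right_mono norm_blinfun_compose) auto
    also have "\<dots> \<le> ((2 * norm ?x) * norm (b - a)) * 2"
      using yx RD(3) SD(3) by (intro mult_mono) (auto simp: norm_minus_commute)
    finally have RS: "norm (?R - ?S) \<le> 4 * norm ?x * norm (b - a)" by simp
    have "chart J (lag_graph M ?x) (lag_graph M ?y) - chart J (lag_graph M ?x) (lag_graph M ?x) - pushforward M a (b - a)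
        = sandwich (?A o\<^sub>L ?S) ((?R - ?S) o\<^sub>L ?B) (b - a)"
      unfolding chart_transition[OF M a b(1) W near] at_a pushforward_def
      by (intro hs_eqI blinfun_eqI) (simp add: hs_op_simps blinfun.bilinear_simps)
    also have "norm \<dots> \<le> norm (?A o\<^sub>L ?S) * norm ((?R - ?S) o\<^sub>L ?B) * norm (b - a)"
      by (rule norm_sandwich_le)
    also have "\<dots> \<le> norm (?A o\<^sub>L ?S) * ((4 * norm ?x * norm (b - a)) * norm ?B) * norm (b - a)"
      using RS by (intro mult_right_mono mult_left_mono order_trans[OF norm_blinfun_compose]) auto
    also have "\<dots> = (norm (?A o\<^sub>L ?S) * 4 * norm ?x * norm ?B) * (norm (b - a))\<^sup>2"
      by (simp add: power2_eq_square)
    finally show "norm (chart J (lag_graph M ?x) (lag_graph M ?y) - chart J (lag_graph M ?x) (lag_graph M ?x)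
        - pushforward M a (b - a)) \<le> (norm (?A o\<^sub>L ?S) * 4 * norm ?x * norm ?B) * (norm (b - a))\<^sup>2" .
  qed
qed

lemma to_tangent_eq_pushforward:
  assumes L0: "L0 \<in> lagrangian J" and M: "M \<in> orbit J L0" and a: "a \<in> B2s M" and h: "h \<in> B2s M"
  shows "to_tangent J L0 M a h = pushforward M a h"
proof -
  have LM: "M \<in> lagrangian J" using orbit_lagrangian[OF L0 M] .
  have W: "lag_graph M (hs_op a) \<in> lagrangian J"
    using orbit_lagrangian[OF L0 lag_graph_orbit[OF LM M a]] .
  let ?f = "\<lambda>b. chart J (chart_inv J L0 M a) (chart_inv J L0 M b)"
  have "(?f has_derivative pushforward M a) (at a within B2s M)"
    by (rule has_derivative_transform[OF a _ chart_transition_has_derivative[OF LM a W]])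
      (simp add: chart_inv_eq[OF L0 M] a)
  moreover from this have "(?f has_derivative to_tangent J L0 M a) (at a within B2s M)"
    unfolding to_tangent_def by (metis differentiableI frechet_derivative_works)
  ultimately show ?thesis
    using has_derivative_within_subspace_line[OF _ subspace_B2s a h] vector_derivative_unique_at by metis
qed

lemma chart_metric_eq:
  assumes L0: "L0 \<in> lagrangian J" and M: "M \<in> orbit J L0"
    and a: "a \<in> B2s M" and h: "h \<in> B2s M" and k: "k \<in> B2s M"
  shows "chart_metric J L0 M a h k = pushforward M a h \<bullet> pushforward M a k"
proof -
  have LM: "M \<in> lagrangian J" using orbit_lagrangian[OF L0 M] .
  let ?W = "lag_graph M (hs_op a)"
  have W: "?W \<in> lagrangian J" using orbit_lagrangian[OF L0 lag_graph_orbit[OF LM M a]] .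
  have x: "sym_on M (hs_op a)" using a by (simp add: B2s_iff)
  have "adj (hs_op (pushforward M a h)) u \<in> ?W" for h u
    by (simp add: pushforward_def frame[OF LM x] resolvent[OF LM x])
  then show ?thesis
    using lagrangianD[OF W]
    by (simp add: chart_metric_def ambient_metric_def to_tangent_eq_pushforward[OF L0 M a] h k
        chart_inv_eq[OF L0 M a] tr_on_eq_inner)
qed

lemma pushforward_0:
  assumes "M \<in> lagrangian J" "h \<in> B2s M"
  shows "pushforward M 0 h = h"
proof -
  have x: "sym_on M (hs_op (0 :: 'a hs))"
    using subspace_0[OF subspace_B2s] by (simp add: B2s_iff)
  show ?thesis
    using resolvent(1)[OF assms(1) x] assms(2)
    by (intro hs_eqI blinfun_eqI)
      (simp add: pushforward_def frame_simps hs_op_simps blinfun.bilinear_simps sym_onD[OF assms(1)] B2s_iff)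
qed

text \<open>The symmetry \<open>U = 2 P - 1\<close> maps the frame at \<open>x\<close> to the frame at \<open>- x\<close> and leaves \<open>S\<close> unchanged, so it
  conjugates the differentials at \<open>x\<close> and \<open>- x\<close>, and conjugation by an orthogonal operator preserves the
  Hilbert--Schmidt inner product.\<close>

lemma chart_metric_even:
  assumes L0: "L0 \<in> lagrangian J" and M: "M \<in> orbit J L0"
    and a: "a \<in> B2s M" and h: "h \<in> B2s M" and k: "k \<in> B2s M"
  shows "chart_metric J L0 M (- a) h k = chart_metric J L0 M a h k"
proof -
  have LM: "M \<in> lagrangian J" using orbit_lagrangian[OF L0 M] .
  have x: "sym_on M (hs_op a)" using a by (simp add: B2s_iff)
  note xD = sym_onD[OF LM x] and PD = proj_lagrangian[OF LM]
  define U where "U = 2 *\<^sub>R proj M - id_blinfun"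
  have adjU: "adj U = U" by (simp add: U_def PD)
  have UU: "adj U o\<^sub>L U = id_blinfun"
    unfolding adjU by (rule blinfun_eqI) (simp add: U_def blinfun.bilinear_simps PD scaleR_2)
  have "(- hs_op a) o\<^sub>L (- hs_op a) = hs_op a o\<^sub>L hs_op a"
    by (rule blinfun_eqI) (simp add: blinfun.bilinear_simps)
  then have S: "resolvent (hs_op (- a)) = resolvent (hs_op a)"
    by (simp add: cross_inverse_def hs_op_simps)
  have "lag_frame M (hs_op (- a)) u = U (lag_frame M (hs_op a) u)"
    "lag_coframe M (hs_op (- a)) u = lag_coframe M (hs_op a) (U u)" for u
    by (simp_all add: frame_simps U_def hs_op_simps blinfun.bilinear_simps PD scaleR_2
        sym_on_J_proj[OF LM x] sym_on_J_proj(2)[OF LM x xD(4)])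
  then have "pushforward M (- a) h = sandwich U (adj U) (pushforward M a h)" for h
    unfolding pushforward_def S adjU by (intro hs_eqI blinfun_eqI) simp
  then show ?thesis
    using subspace_neg[OF subspace_B2s a] by (simp add: chart_metric_eq[OF L0 M] a h k inner_sandwich_isometry[OF UU])
qed

text \<open>By evenness the derivative of the metric vanishes at the origin. Hence \<open>\<Gamma> M 0 u v \<bullet> k\<close> is symmetric in
  \<open>u, v\<close> and antisymmetric in \<open>v, k\<close>, and a trilinear form with these symmetries is zero.\<close>

lemma christoffel_at_origin:
  assumes L0: "L0 \<in> lagrangian J" and lc: "levi_civita J L0 \<Gamma>" and M: "M \<in> orbit J L0"
    and u: "u \<in> B2s M" and v: "v \<in> B2s M"
  shows "\<Gamma> M 0 u v = 0"
proof -
  have LM: "M \<in> lagrangian J" using orbit_lagrangian[OF L0 M] .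
  have 0: "0 \<in> B2s M" by (rule subspace_0[OF subspace_B2s])
  have closed: "\<Gamma> M 0 u v \<in> B2s M" if "u \<in> B2s M" "v \<in> B2s M" for u v
    using lc M 0 that unfolding levi_civita_def by blast
  have sym: "\<Gamma> M 0 u v = \<Gamma> M 0 v u" if "u \<in> B2s M" "v \<in> B2s M" for u v
    using lc M 0 that unfolding levi_civita_def by blast
  have g0: "chart_metric J L0 M 0 h k = h \<bullet> k" if "h \<in> B2s M" "k \<in> B2s M" for h k
    using that by (simp add: chart_metric_eq[OF L0 M 0] pushforward_0[OF LM])
  have skew: "\<Gamma> M 0 z h \<bullet> k = - (h \<bullet> \<Gamma> M 0 z k)" if z: "z \<in> B2s M" and h: "h \<in> B2s M" and k: "k \<in> B2s M" for z h k
  proof -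
    let ?f = "\<lambda>y. chart_metric J L0 M y h k"
    have "\<exists>D. (?f has_derivative D) (at 0 within B2s M) \<and>
        (\<forall>z\<in>B2s M. D z = chart_metric J L0 M 0 (\<Gamma> M 0 z h) k + chart_metric J L0 M 0 h (\<Gamma> M 0 z k))"
      using lc M 0 h k unfolding levi_civita_def by blast
    then obtain D where D: "(?f has_derivative D) (at 0 within B2s M)"
      and Dz: "\<forall>z\<in>B2s M. D z = chart_metric J L0 M 0 (\<Gamma> M 0 z h) k + chart_metric J L0 M 0 h (\<Gamma> M 0 z k)"
      by (elim exE conjE)
    have "?f (0 + s *\<^sub>R (- z)) = ?f (0 + s *\<^sub>R z)" for s
      using chart_metric_even[OF L0 M subspace_scale[OF subspace_B2s z] h k, of s] by simp
    then have "D (- z) = D z"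
      using has_derivative_within_subspace_line[OF D subspace_B2s 0 z]
        has_derivative_within_subspace_line[OF D subspace_B2s 0 subspace_neg[OF subspace_B2s z]]
      by (simp add: vector_derivative_unique_at)
    then have "D z = 0" using linear_neg[OF has_derivative_linear[OF D], of z] by simp
    then show ?thesis using Dz z h k closed g0 by simp
  qed
  have "\<Gamma> M 0 u v \<bullet> k = 0" if k: "k \<in> B2s M" for k
  proof -
    have "\<Gamma> M 0 u v \<bullet> k = - (v \<bullet> \<Gamma> M 0 u k)" using skew u v k by blast
    also have "\<dots> = - (\<Gamma> M 0 k u \<bullet> v)" by (simp add: sym[OF u k] inner_commute)
    also have "\<dots> = u \<bullet> \<Gamma> M 0 k v" using skew[OF k u v] by simp
    also have "\<dots> = \<Gamma> M 0 v k \<bullet> u" by (simp add: sym[OF k v] inner_commute)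
    also have "\<dots> = - (k \<bullet> \<Gamma> M 0 v u)" by (rule skew[OF v k u])
    also have "\<dots> = - (\<Gamma> M 0 u v \<bullet> k)" by (simp add: sym[OF v u] inner_commute)
    finally show ?thesis by simp
  qed
  from this[OF closed[OF u v]] show ?thesis by simp
qed

end


section \<open>The exponential of a bounded operator\<close>

definition op_power :: "('a::{real_inner,banach} \<Rightarrow>\<^sub>L 'a) \<Rightarrow> nat \<Rightarrow> ('a \<Rightarrow>\<^sub>L 'a)" where
  "op_power A n = ((\<lambda>B. A o\<^sub>L B) ^^ n) id_blinfun"

lemma op_power_simps: "op_power A 0 = id_blinfun" "op_power A (Suc n) = A o\<^sub>L op_power A n"
  by (simp_all add: op_power_def)

lemma norm_op_power_le: "norm (op_power A n) \<le> norm A ^ n"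
proof (induction n)
  case 0
  show ?case by (simp add: op_power_simps norm_blinfun_id_le)
next
  case (Suc n)
  have "norm (op_power A (Suc n)) \<le> norm A * norm (op_power A n)"
    unfolding op_power_simps by (rule norm_blinfun_compose)
  also have "\<dots> \<le> norm A * norm A ^ n" using Suc by (rule mult_left_mono) simp
  finally show ?case by simp
qed

lemma op_power_scaleR: "op_power (t *\<^sub>R A) n = t ^ n *\<^sub>R op_power A n"
proof (induction n)
  case (Suc n)
  then show ?case
    by (intro blinfun_eqI) (simp add: op_power_simps blinfun.bilinear_simps)
qed (simp add: op_power_simps)

lemma op_power_commute: "op_power A n (A u) = A (op_power A n u)"
  by (induction n) (simp_all add: op_power_simps)

lemma bexp_eq: "bexp (t *\<^sub>R A) = (\<Sum>n. (t ^ n / fact n) *\<^sub>R op_power A n)"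
  by (simp add: bexp_def op_power_scaleR flip: op_power_def)

lemma bexp_0: "bexp 0 = id_blinfun"
proof -
  have "(\<lambda>n. (0 ^ n / fact n) *\<^sub>R op_power A n) sums (\<Sum>n\<in>{0}. (0 ^ n / fact n) *\<^sub>R op_power A n)" for A :: "'a \<Rightarrow>\<^sub>L 'a"
    by (rule sums_finite) auto
  then show ?thesis using bexp_eq[of 0 "0 :: 'a \<Rightarrow>\<^sub>L 'a"] by (simp add: op_power_simps sums_iff)
qed

lemma bexp_uniform_limit:
  "uniform_limit {-r<..<r} (\<lambda>n t. \<Sum>i<n. (t ^ i / fact i) *\<^sub>R op_power A i) (\<lambda>t. bexp (t *\<^sub>R A)) sequentially"
  unfolding bexp_eq
proof (rule Weierstrass_m_test)
  show "summable (\<lambda>n. inverse (fact n) * (r * norm A) ^ n)" by (rule summable_exp)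
  fix n t assume "t \<in> {-r<..<r}"
  then have "\<bar>t\<bar> ^ n * norm (op_power A n) \<le> r ^ n * norm A ^ n"
    by (intro mult_mono power_mono norm_op_power_le) auto
  then show "norm ((t ^ n / fact n) *\<^sub>R op_power A n) \<le> inverse (fact n) * (r * norm A) ^ n"
    by (simp add: power_abs power_mult_distrib divide_simps)
qed

text \<open>Termwise differentiation of the exponential series turns it into \<open>A\<close> times itself, and on a bounded
  interval the convergence is uniform by the Weierstrass test.\<close>

lemma bexp_has_vector_derivative:
  "((\<lambda>t. bexp (t *\<^sub>R A)) has_vector_derivative (A o\<^sub>L bexp (t *\<^sub>R A))) (at t)"
proof -
  define r where "r = \<bar>t\<bar> + 1"
  let ?S = "{-r<..<r}"
  let ?f = "\<lambda>n t. (t ^ n / fact n) *\<^sub>R op_power A n"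
  let ?c = "\<lambda>n t. (real n * t ^ (n - 1) / fact n) *\<^sub>R op_power A n"
  have t: "t \<in> ?S" by (auto simp: r_def)
  \<comment> \<open>the derivatives of the first \<open>n + 1\<close> terms add up to \<open>A\<close> times the first \<open>n\<close> terms\<close>
  have shift: "(\<Sum>i<Suc n. ?c i s) = A o\<^sub>L (\<Sum>i<n. ?f i s)" for n s
  proof -
    have "?c (Suc i) s = A o\<^sub>L ?f i s" for i
      by (rule blinfun_eqI) (simp add: op_power_simps blinfun.bilinear_simps fact_reduce del: of_nat_Suc)
    moreover have "A o\<^sub>L (\<Sum>i<n. ?f i s) = (\<Sum>i<n. A o\<^sub>L ?f i s)"
      by (rule bounded_bilinear.sum_right[OF bounded_bilinear_blinfun_compose])
    ultimately show ?thesis by (simp add: sum.lessThan_Suc_shift del: sum.lessThan_Suc)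
  qed
  have unif: "\<forall>\<^sub>F n in sequentially. \<forall>s\<in>?S. \<forall>h.
      norm ((\<Sum>i<n. h *\<^sub>R ?c i s) - h *\<^sub>R (A o\<^sub>L bexp (s *\<^sub>R A))) \<le> e * norm h" if e: "e > 0" for e
  proof -
    have "e / (norm A + 1) > 0" using e by (simp add: add_nonneg_pos)
    from uniform_limitD[OF bexp_uniform_limit this, of r A]
    have "\<forall>\<^sub>F n in sequentially. \<forall>s\<in>?S. dist (\<Sum>i<n. ?f i s) (bexp (s *\<^sub>R A)) < e / (norm A + 1)" .
    then have "\<forall>\<^sub>F n in sequentially. \<forall>s\<in>?S. \<forall>h.
      norm ((\<Sum>i<Suc n. h *\<^sub>R ?c i s) - h *\<^sub>R (A o\<^sub>L bexp (s *\<^sub>R A))) \<le> e * norm h"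
    proof (rule eventually_mono, intro ballI allI)
      fix n s h
      assume "\<forall>s\<in>?S. dist (\<Sum>i<n. ?f i s) (bexp (s *\<^sub>R A)) < e / (norm A + 1)" and s: "s \<in> ?S"
      then have d: "norm ((\<Sum>i<n. ?f i s) - bexp (s *\<^sub>R A)) \<le> e / (norm A + 1)"
        by (auto simp: dist_norm intro: less_imp_le)
      have "(\<Sum>i<Suc n. h *\<^sub>R ?c i s) - h *\<^sub>R (A o\<^sub>L bexp (s *\<^sub>R A))
          = h *\<^sub>R (A o\<^sub>L ((\<Sum>i<n. ?f i s) - bexp (s *\<^sub>R A)))"
        unfolding scaleR_sum_right[symmetric] shift
        by (rule blinfun_eqI) (simp add: blinfun.bilinear_simps algebra_simps)
      also have "norm \<dots> \<le> \<bar>h\<bar> * (norm A * norm ((\<Sum>i<n. ?f i s) - bexp (s *\<^sub>R A)))"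
        by (simp add: mult_left_mono norm_blinfun_compose)
      also have "\<dots> \<le> \<bar>h\<bar> * ((norm A + 1) * (e / (norm A + 1)))"
        using d by (intro mult_left_mono mult_mono) auto
      also have "(norm A + 1) * (e / (norm A + 1)) = e"
        using norm_ge_zero[of A] by (simp add: add_nonneg_eq_0_iff)
      finally show "norm ((\<Sum>i<Suc n. h *\<^sub>R ?c i s) - h *\<^sub>R (A o\<^sub>L bexp (s *\<^sub>R A))) \<le> e * norm h"
        by (simp add: mult.commute)
    qed
    then show ?thesis by (subst (asm) eventually_sequentially_Suc)
  qed
  have sums: "(\<lambda>n. ?f n s) sums bexp (s *\<^sub>R A)" if "s \<in> ?S" for s
    using tendsto_uniform_limitI[OF bexp_uniform_limit that] by (simp add: sums_def)
  have "\<exists>g. \<forall>s\<in>?S. (\<lambda>n. ?f n s) sums g s \<and>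
      (g has_derivative (\<lambda>h. h *\<^sub>R (A o\<^sub>L bexp (s *\<^sub>R A)))) (at s within ?S)"
  proof (rule has_derivative_series[where f' = "\<lambda>n s h. h *\<^sub>R ?c n s"
        and g' = "\<lambda>s h. h *\<^sub>R (A o\<^sub>L bexp (s *\<^sub>R A))" and x = t])
    show "(\<lambda>n. ?f n t) sums bexp (t *\<^sub>R A)" by (rule sums[OF t])
    show "\<forall>\<^sub>F n in sequentially. \<forall>s\<in>?S. \<forall>h.
      norm ((\<Sum>i<n. h *\<^sub>R ?c i s) - h *\<^sub>R (A o\<^sub>L bexp (s *\<^sub>R A))) \<le> e * norm h" if "e > 0" for e
      using that by (rule unif)
    fix n s
    show "(?f n has_derivative (\<lambda>h. h *\<^sub>R ?c n s)) (at s within ?S)"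
      by (auto intro!: derivative_eq_intros simp: field_simps)
  qed (use t in auto)
  then obtain g where g: "\<And>s. s \<in> ?S \<Longrightarrow> (\<lambda>n. ?f n s) sums g s"
    "(g has_derivative (\<lambda>h. h *\<^sub>R (A o\<^sub>L bexp (t *\<^sub>R A)))) (at t within ?S)" using t by blast
  have "g s = bexp (s *\<^sub>R A)" if "s \<in> ?S" for s using g(1) sums that sums_unique2 by blast
  then have "((\<lambda>s. bexp (s *\<^sub>R A)) has_derivative (\<lambda>h. h *\<^sub>R (A o\<^sub>L bexp (t *\<^sub>R A)))) (at t within ?S)"
    using has_derivative_transform[OF t _ g(2)] by simp
  then show ?thesis using t by (simp add: has_vector_derivative_def at_within_open[of t ?S])
qed

lemma bexp_commute: "bexp (t *\<^sub>R A) (A u) = A (bexp (t *\<^sub>R A) u)"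
proof -
  let ?f = "\<lambda>n. (t ^ n / fact n) *\<^sub>R op_power A n"
  have "t \<in> {-(\<bar>t\<bar> + 1)<..<\<bar>t\<bar> + 1}" by auto
  from tendsto_uniform_limitI[OF bexp_uniform_limit this]
  have sums: "?f sums bexp (t *\<^sub>R A)" by (simp add: sums_def)
  have "?f n o\<^sub>L A = A o\<^sub>L ?f n" for n
    by (rule blinfun_eqI) (simp add: blinfun.bilinear_simps op_power_commute)
  then have "bexp (t *\<^sub>R A) o\<^sub>L A = A o\<^sub>L bexp (t *\<^sub>R A)"
    using bounded_linear.sums[OF bounded_bilinear.bounded_linear_left[OF bounded_bilinear_blinfun_compose, of A] sums]
      bounded_linear.sums[OF bounded_bilinear.bounded_linear_right[OF bounded_bilinear_blinfun_compose, of A] sums]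
    by (simp add: sums_unique2)
  from arg_cong[OF this, of "\<lambda>B. blinfun_apply B u"] show ?thesis by simp
qed

lemma blinfun_compose_has_vector_derivative:
  assumes "(f has_vector_derivative f') (at t within S)" "(g has_vector_derivative g') (at t within S)"
  shows "((\<lambda>t. f t o\<^sub>L g t) has_vector_derivative ((f t o\<^sub>L g') + (f' o\<^sub>L g t))) (at t within S)"
  using bounded_bilinear.has_vector_derivative[OF bounded_bilinear_blinfun_compose assms] by simp

lemma bexp_minus_has_vector_derivative:
  "((\<lambda>t. bexp ((- t) *\<^sub>R A)) has_vector_derivative (- (A o\<^sub>L bexp ((- t) *\<^sub>R A)))) (at t within S)"
proof -
  have "(uminus has_vector_derivative - 1) (at t)"
    by (auto intro!: derivative_eq_intros simp: has_vector_derivative_def)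
  from vector_diff_chain_at[OF this bexp_has_vector_derivative, of A]
  have "((\<lambda>t. bexp ((- t) *\<^sub>R A)) has_vector_derivative (- (A o\<^sub>L bexp ((- t) *\<^sub>R A)))) (at t)"
    by (simp add: o_def)
  then show ?thesis by (rule has_vector_derivative_at_within)
qed

text \<open>The derivative of \<open>bexp (- s A) bexp ((s + t) A)\<close> in \<open>s\<close> vanishes.\<close>

lemma bexp_add: "bexp (s *\<^sub>R A) o\<^sub>L bexp (t *\<^sub>R A) = bexp ((s + t) *\<^sub>R A)"
proof -
  have const: "bexp ((- s) *\<^sub>R A) o\<^sub>L bexp ((s + t) *\<^sub>R A) = bexp (t *\<^sub>R A)" for s t
  proof -
    let ?F = "\<lambda>s. bexp ((- s) *\<^sub>R A) o\<^sub>L bexp ((s + t) *\<^sub>R A)"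
    have "(?F has_vector_derivative 0) (at s within UNIV)" for s
    proof -
      have "((\<lambda>s. s + t) has_vector_derivative 1) (at s)"
        by (auto intro!: derivative_eq_intros simp: has_vector_derivative_def)
      from vector_diff_chain_at[OF this bexp_has_vector_derivative, of A]
      have "((\<lambda>s. bexp ((s + t) *\<^sub>R A)) has_vector_derivative (A o\<^sub>L bexp ((s + t) *\<^sub>R A))) (at s)"
        by (simp add: o_def)
      from blinfun_compose_has_vector_derivative[OF bexp_minus_has_vector_derivative this]
      have "(?F has_vector_derivative (bexp ((- s) *\<^sub>R A) o\<^sub>L (A o\<^sub>L bexp ((s + t) *\<^sub>R A))) +
          (- (A o\<^sub>L bexp ((- s) *\<^sub>R A)) o\<^sub>L bexp ((s + t) *\<^sub>R A))) (at s)" .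
      moreover have "(bexp ((- s) *\<^sub>R A) o\<^sub>L (A o\<^sub>L bexp ((s + t) *\<^sub>R A))) +
          (- (A o\<^sub>L bexp ((- s) *\<^sub>R A)) o\<^sub>L bexp ((s + t) *\<^sub>R A)) = 0"
        by (intro blinfun_eqI) (simp add: blinfun.bilinear_simps bexp_commute[of "- s", simplified])
      ultimately show ?thesis by simp
    qed
    then obtain c where c: "\<And>s. ?F s = c"
      using has_vector_derivative_zero_constant[OF convex_UNIV, of ?F] by (metis UNIV_I)
    have "?F 0 = bexp (t *\<^sub>R A)" by (rule blinfun_eqI) (simp add: bexp_0)
    then show ?thesis using c[of 0] c[of s] by (simp only:)
  qed
  have inv: "bexp (s *\<^sub>R A) o\<^sub>L bexp ((- s) *\<^sub>R A) = id_blinfun" for s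
    using const[of "- s" 0] by (simp add: bexp_0)
  have "bexp (s *\<^sub>R A) o\<^sub>L bexp (t *\<^sub>R A)
      = (bexp (s *\<^sub>R A) o\<^sub>L bexp ((- s) *\<^sub>R A)) o\<^sub>L bexp ((s + t) *\<^sub>R A)"
    unfolding const[of s t, symmetric] by (rule blinfun_eqI) simp
  then show ?thesis unfolding inv by (simp add: blinfun_eqI)
qed


section \<open>The velocity of a geodesic\<close>

lemma at_within_Icc_neq_bot: "t \<in> {0..1::real} \<Longrightarrow> at t within {0..1} \<noteq> bot"
  by (simp add: trivial_limit_within)

lemma has_vector_derivative_zero_unique:
  assumes "convex S" "\<And>t. t \<in> S \<Longrightarrow> (f has_vector_derivative 0) (at t within S)" "s \<in> S" "t \<in> S"
  shows "f s = f t"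
  by (rule has_derivative_zero_unique[OF assms(1) _ assms(3,4)])
    (use assms(2) in \<open>simp add: has_vector_derivative_def\<close>)

text \<open>The space \<open>B2s M\<close> is the common fixed space of two bounded linear maps, compression to \<open>M\<close> and the
  adjoint. So velocities of curves in it stay in it.\<close>

lemma has_vector_derivative_fixed:
  assumes F: "bounded_linear F" and f: "(f has_vector_derivative v) (at t within S)"
    and S: "at t within S \<noteq> bot" "t \<in> S" and fix_f: "\<And>s. s \<in> S \<Longrightarrow> F (f s) = f s"
  shows "F v = v"
proof -
  have "((\<lambda>s. F (f s)) has_vector_derivative F v) (at t within S)"
    by (rule bounded_linear.has_vector_derivative[OF F f])
  then have "(f has_vector_derivative F v) (at t within S)"
    using has_vector_derivative_transform[OF S(2), of f "\<lambda>s. F (f s)"] fix_f by simp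
  then show ?thesis using vector_derivative_unique_within[OF S(1) _ f] by blast
qed

lemma bounded_linear_Hs_adj: "bounded_linear (\<lambda>a. Hs (adj (hs_op a)))"
proof (rule bounded_linear_intro[where K = 1])
  fix x y :: "'a hs" and r :: real
  have hs: "hs_op (Hs (adj (hs_op x))) = adj (hs_op x)" for x :: "'a hs"
    by (simp add: hs_op_Hs hilbert_schmidt_adj hilbert_schmidt_hs_op)
  show "Hs (adj (hs_op (x + y))) = Hs (adj (hs_op x)) + Hs (adj (hs_op y))"
    "Hs (adj (hs_op (r *\<^sub>R x))) = r *\<^sub>R Hs (adj (hs_op x))"
    by (rule hs_eqI, simp only: hs, simp only: hs_op_simps hs adj_simps)+
qed (simp add: norm_Hs_adj)

context complex_structure
begin

lemma B2s_fixed_iff: "a \<in> B2s M \<longleftrightarrow> sandwich (proj M) (proj M) a = a \<and> Hs (adj (hs_op a)) = a"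
proof -
  have "Hs (adj (hs_op a)) = a \<longleftrightarrow> adj (hs_op a) = hs_op a"
    by (metis hs_op_Hs hs_op_inverse hilbert_schmidt_adj hilbert_schmidt_hs_op)
  moreover have "sandwich (proj M) (proj M) a = a \<longleftrightarrow> proj M o\<^sub>L hs_op a o\<^sub>L proj M = hs_op a"
    using hs_op_sandwich[of "proj M" "proj M" a] by (metis hs_op_inverse)
  ultimately show ?thesis by (simp add: B2s_def)
qed

lemma B2s_derivative:
  assumes "(f has_vector_derivative v) (at t within S)" "at t within S \<noteq> bot" "t \<in> S"
    and "\<And>s. s \<in> S \<Longrightarrow> f s \<in> B2s M"
  shows "v \<in> B2s M"
  unfolding B2s_fixed_iff
  using has_vector_derivative_fixed[OF bounded_linear_sandwich assms(1-3), of "proj M" "proj M"]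
    has_vector_derivative_fixed[OF bounded_linear_Hs_adj assms(1-3)] assms(4)
  by (simp add: B2s_fixed_iff)

text \<open>The set \<open>N\<close> of times in the domain of one chart is open in the unit interval, so derivatives within \<open>N\<close>
  are derivatives within the interval. Working within \<open>N\<close> makes the description of \<open>\<xi>\<close> as a graph valid
  at all the times that matter for the derivative.\<close>

lemma geodesic_chart:
  assumes L0: "L0 \<in> lagrangian J" and geo: "geodesic J L0 \<Gamma> \<xi>" and M: "M \<in> orbit J L0"
  shows "\<exists>N x' x''. N = {t\<in>{0..1}. \<xi> t \<in> chart_dom J L0 M} \<and>
    (\<forall>t\<in>N. at t within N = at t within {0..1} \<and>
      chart J M (\<xi> t) \<in> B2s M \<and> \<xi> t = lag_graph M (hs_op (chart J M (\<xi> t))) \<and>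
      ((\<lambda>s. chart J M (\<xi> s)) has_vector_derivative x' t) (at t within N) \<and> x' t \<in> B2s M \<and>
      (x' has_vector_derivative x'' t) (at t within N) \<and>
      x'' t + \<Gamma> M (chart J M (\<xi> t)) (x' t) (x' t) = 0)"
proof -
  define N where "N = {t\<in>{0..1}. \<xi> t \<in> chart_dom J L0 M}"
  have "openin (top_of_set {0..1}) N" using geo M unfolding geodesic_def N_def by blast
  then obtain U where U: "open U" "N = {0..1} \<inter> U" by (auto simp: openin_open)
  have within: "at t within N = at t within {0..1}" if "t \<in> N" for t
    by (rule at_within_nhd[of t U]) (use that U in auto)
  have bot: "at t within N \<noteq> bot" if "t \<in> N" for t
    using within[OF that] at_within_Icc_neq_bot[of t] that by (simp add: N_def)
  obtain x' x'' where D: "\<forall>t\<in>{0..1}. \<xi> t \<in> chart_dom J L0 M \<longrightarrow>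
           ((\<lambda>s. chart J M (\<xi> s)) has_vector_derivative x' t) (at t within {0..1}) \<and>
           (x' has_vector_derivative x'' t) (at t within {0..1}) \<and>
           x'' t + \<Gamma> M (chart J M (\<xi> t)) (x' t) (x' t) = 0"
    using geo M unfolding geodesic_def by blast
  have mem: "chart J M (\<xi> t) \<in> B2s M" "\<xi> t = lag_graph M (hs_op (chart J M (\<xi> t)))" if "t \<in> N" for t
    using chart_domD[OF L0 M, of "\<xi> t"] that by (auto simp: N_def)
  have x': "((\<lambda>s. chart J M (\<xi> s)) has_vector_derivative x' t) (at t within N)" if "t \<in> N" for t
    using D that within[OF that] by (simp add: N_def)
  have "x' t \<in> B2s M" if "t \<in> N" for t
    using B2s_derivative[OF x'[OF that] bot[OF that] that mem(1)] by simp
  moreover have "(x' has_vector_derivative x'' t) (at t within N)"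
    "x'' t + \<Gamma> M (chart J M (\<xi> t)) (x' t) (x' t) = 0" if "t \<in> N" for t
    using D that within[OF that] by (simp_all add: N_def)
  ultimately show ?thesis
    by (intro exI[of _ N] exI[of _ x'] exI[of _ x''] conjI ballI N_def within mem x')
qed

lemma lag_graph_0:
  shows "lag_graph M (hs_op (0 :: 'a hs)) = M"
  by (simp add: lag_graph_def hs_op_simps blinfun.bilinear_simps)

lemma chart_self: "M \<in> lagrangian J \<Longrightarrow> chart J M M = 0"
  using chart_lag_graph[of M 0] subspace_0[OF subspace_B2s] by (simp add: lag_graph_0)

lemma chart_dom_self:
  "L0 \<in> lagrangian J \<Longrightarrow> M \<in> orbit J L0 \<Longrightarrow> M \<in> chart_dom J L0 M"
  using lag_graph_chart_dom[of M L0 0] subspace_0[OF subspace_B2s]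
  by (simp add: lag_graph_0 orbit_lagrangian)

lemma has_velocity_unique:
  "t \<in> {0..1} \<Longrightarrow> has_velocity J \<xi> t v \<Longrightarrow> has_velocity J \<xi> t w \<Longrightarrow> v = w"
  unfolding has_velocity_def using vector_derivative_unique_within[OF at_within_Icc_neq_bot] by blast

text \<open>The velocity is defined in the chart centred at the moving point. This expresses it in one fixed
  chart, in which it can be differentiated.\<close>

lemma has_velocity_in_chart:
  assumes M: "M \<in> lagrangian J" and t: "t \<in> N" and N: "at t within N = at t within {0..1}"
    and x: "\<And>s. s \<in> N \<Longrightarrow> x s \<in> B2s M" and \<xi>: "\<And>s. s \<in> N \<Longrightarrow> \<xi> s = lag_graph M (hs_op (x s))"
    and W: "\<xi> t \<in> lagrangian J"
    and x': "(x has_vector_derivative x') (at t within N)"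
  shows "has_velocity J \<xi> t (pushforward M (x t) x')"
proof -
  let ?f = "\<lambda>b. chart J (\<xi> t) (lag_graph M (hs_op b))"
  have "(?f has_derivative pushforward M (x t)) (at (x t) within x ` N)"
    using chart_transition_has_derivative[OF M x[OF t]] W \<xi>[OF t] x
    by (auto intro: has_derivative_subset)
  from has_derivative_in_compose[OF x'[unfolded has_vector_derivative_def] this]
  have "((\<lambda>s. ?f (x s)) has_vector_derivative pushforward M (x t) x') (at t within N)"
    unfolding has_vector_derivative_def pushforward_def
    by (simp add: linear_scale[OF bounded_linear.linear[OF bounded_linear_sandwich]])
  then have "((\<lambda>s. chart J (\<xi> t) (\<xi> s)) has_vector_derivative pushforward M (x t) x') (at t within N)"
    by (rule has_vector_derivative_transform[OF t, rotated]) (simp add: \<xi>)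
  then show ?thesis by (simp add: has_velocity_def N)
qed

lemma hs_op_has_vector_derivative:
  "(f has_vector_derivative v) F \<Longrightarrow> ((\<lambda>t. hs_op (f t)) has_vector_derivative hs_op v) F"
  by (rule bounded_linear.has_vector_derivative[OF bounded_linear_hs_op])

lemma const_compose_has_vector_derivative:
  assumes "(f has_vector_derivative f') F"
  shows "((\<lambda>t. C o\<^sub>L f t) has_vector_derivative (C o\<^sub>L f')) F"
    "((\<lambda>t. f t o\<^sub>L C) has_vector_derivative (f' o\<^sub>L C)) F"
  using bounded_linear.has_vector_derivative[OF bounded_bilinear.bounded_linear_right[OF bounded_bilinear_blinfun_compose] assms]
    bounded_linear.has_vector_derivative[OF bounded_bilinear.bounded_linear_left[OF bounded_bilinear_blinfun_compose] assms]
  by auto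

text \<open>With \<open>S\<close> the resolvent, \<open>1 - S = x\<^sup>2 S\<close> is of second order at the centre of the chart.\<close>

lemma resolvent_has_vector_derivative_0:
  assumes M: "M \<in> lagrangian J" and t: "t \<in> N" and x: "\<And>s. s \<in> N \<Longrightarrow> x s \<in> B2s M" and xt: "x t = 0"
    and x': "(x has_vector_derivative x') (at t within N)"
  shows "((\<lambda>s. resolvent (hs_op (x s))) has_vector_derivative 0) (at t within N)"
    "resolvent (hs_op (x t)) = id_blinfun"
proof -
  have 0: "0 \<in> B2s M" by (rule subspace_0[OF subspace_B2s])
  have S0: "resolvent (hs_op (0 :: 'a hs)) = id_blinfun"
    using resolvent(1)[OF M 0[unfolded B2s_iff]]
    by (intro blinfun_eqI) (simp add: hs_op_simps)
  then show "resolvent (hs_op (x t)) = id_blinfun" by (simp add: xt)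
  have "((\<lambda>a. resolvent (hs_op a)) has_derivative (\<lambda>_. 0)) (at 0 within B2s M)"
  proof (rule has_derivative_quadratic_error[where e = 1 and K = 2])
    fix a assume a: "a \<in> B2s M"
    note S = resolvent[OF M a[unfolded B2s_iff]]
    let ?a = "hs_op a" and ?S = "resolvent (hs_op a)"
    have "?S - id_blinfun = - (?a o\<^sub>L ?a o\<^sub>L ?S)"
      by (rule blinfun_eqI) (use S(1) in \<open>simp add: blinfun.bilinear_simps algebra_simps\<close>)
    then have "norm (?S - id_blinfun) \<le> norm (?a o\<^sub>L ?a) * norm ?S"
      by (simp add: norm_blinfun_compose)
    also have "\<dots> \<le> (norm ?a * norm ?a) * norm ?S"
      by (intro mult_right_mono norm_blinfun_compose) auto
    also have "\<dots> \<le> (norm a * norm a) * 2"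
      using S(3) norm_hs_op_le[of a] by (intro mult_mono) auto
    finally show "norm (resolvent (hs_op a) - resolvent (hs_op 0) - 0) \<le> 2 * (norm (a - 0))\<^sup>2"
      by (simp add: S0 power2_eq_square mult.commute)
  qed auto
  then have "((\<lambda>a. resolvent (hs_op a)) has_derivative (\<lambda>_. 0)) (at (x t) within x ` N)"
    unfolding xt by (rule has_derivative_subset) (use x in auto)
  from has_derivative_in_compose[OF x'[unfolded has_vector_derivative_def] this]
  show "((\<lambda>s. resolvent (hs_op (x s))) has_vector_derivative 0) (at t within N)"
    by (simp add: has_vector_derivative_def)
qed

lemma frame_has_vector_derivative:
  assumes "(x has_vector_derivative x') (at t within N)"
  shows "((\<lambda>s. lag_frame M (hs_op (x s))) has_vector_derivative (- (J o\<^sub>L hs_op x'))) (at t within N)"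
    "((\<lambda>s. lag_coframe M (hs_op (x s))) has_vector_derivative (hs_op x' o\<^sub>L J)) (at t within N)"
proof -
  note hx = hs_op_has_vector_derivative[OF assms]
  have "((\<lambda>s. proj M - (J o\<^sub>L hs_op (x s))) has_vector_derivative 0 - (J o\<^sub>L hs_op x')) (at t within N)"
    by (intro has_vector_derivative_diff has_vector_derivative_const const_compose_has_vector_derivative hx)
  then show "((\<lambda>s. lag_frame M (hs_op (x s))) has_vector_derivative (- (J o\<^sub>L hs_op x'))) (at t within N)"
    by (simp add: lag_frame_def)
  have "((\<lambda>s. proj M + (hs_op (x s) o\<^sub>L J)) has_vector_derivative 0 + (hs_op x' o\<^sub>L J)) (at t within N)"
    by (intro has_vector_derivative_add has_vector_derivative_const const_compose_has_vector_derivative hx)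
  then show "((\<lambda>s. lag_coframe M (hs_op (x s))) has_vector_derivative (hs_op x' o\<^sub>L J)) (at t within N)"
    by (simp add: lag_coframe_def)
qed

text \<open>For \<open>v\<close> tangent at \<open>W\<close> this is the skew operator that commutes with \<open>J\<close>, exchanges \<open>W\<close> and \<open>W\<^sup>\<bottom>\<close>, and whose
  flow \<open>bexp (- t Y)\<close> moves \<open>W\<close> with initial velocity \<open>v\<close>. Up to a factor and the
  identification by the trace form it is the moment map of the action of the orthogonal operators in \<open>Sp2 J\<close>.\<close>

definition momentum :: "'a hs \<Rightarrow> ('a \<Rightarrow>\<^sub>L 'a)" where
  "momentum v = (J o\<^sub>L hs_op v) + (hs_op v o\<^sub>L J)"

text \<open>Both derivatives are computed at \<open>t\<close> in the chart centred at \<open>M = \<xi> t\<close>. There \<open>x = 0\<close>, the frame and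
  coframe are \<open>P\<close>, the resolvent is constant to first order and \<open>x'' = 0\<close>. With \<open>y = x'\<close> the velocity has
  derivative \<open>y\<^sup>2 J - J y\<^sup>2\<close>, and this is cancelled in the momentum because \<open>J\<^sup>2 = - 1\<close>.\<close>

lemma geodesic_momentum_and_projection:
  assumes L0: "L0 \<in> lagrangian J" and lc: "levi_civita J L0 \<Gamma>" and geo: "geodesic J L0 \<Gamma> \<xi>"
    and v: "\<And>t. t \<in> {0..1} \<Longrightarrow> has_velocity J \<xi> t (v t)" and t: "t \<in> {0..1}"
  shows "((\<lambda>s. momentum (v s)) has_vector_derivative 0) (at t within {0..1})"
    "((\<lambda>s. proj (\<xi> s)) has_vector_derivative
       ((proj (\<xi> t) o\<^sub>L momentum (v t)) - (momentum (v t) o\<^sub>L proj (\<xi> t)))) (at t within {0..1})"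
proof -
  define M where "M = \<xi> t"
  have orb: "\<xi> s \<in> orbit J L0" "\<xi> s \<in> lagrangian J" if "s \<in> {0..1}" for s
    using geo that orbit_lagrangian[OF L0] unfolding geodesic_def by blast+
  have M: "M \<in> orbit J L0" "M \<in> lagrangian J" using orb[OF t] by (auto simp: M_def)
  define x where "x = (\<lambda>s. chart J M (\<xi> s))"
  obtain N x' x'' where N: "N = {t\<in>{0..1}. \<xi> t \<in> chart_dom J L0 M}"
    and D: "\<forall>t\<in>N. at t within N = at t within {0..1} \<and>
      x t \<in> B2s M \<and> \<xi> t = lag_graph M (hs_op (x t)) \<and>
      (x has_vector_derivative x' t) (at t within N) \<and> x' t \<in> B2s M \<and>
      (x' has_vector_derivative x'' t) (at t within N) \<and>
      x'' t + \<Gamma> M (x t) (x' t) (x' t) = 0"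
    using geodesic_chart[OF L0 geo M(1)] unfolding x_def by (elim exE conjE)
  have within: "at t within N = at t within {0..1}" and xB: "x t \<in> B2s M"
    and \<xi>: "\<xi> t = lag_graph M (hs_op (x t))"
    and x': "(x has_vector_derivative x' t) (at t within N)" and x'B: "x' t \<in> B2s M"
    and x'': "(x' has_vector_derivative x'' t) (at t within N)"
    and eq: "x'' t + \<Gamma> M (x t) (x' t) (x' t) = 0" if "t \<in> N" for t
    using bspec[OF D that] by blast+
  have tN: "t \<in> N" using chart_dom_self[OF L0 M(1)] t by (simp add: N M_def)
  have NI: "s \<in> {0..1}" if "s \<in> N" for s using that by (simp add: N)
  have xt: "x t = 0" using chart_self[OF M(2)] by (simp add: x_def M_def)
  have x''t: "x'' t = 0" using eq[OF tN] christoffel_at_origin[OF L0 lc M(1)] x'B[OF tN] xt by simp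
  have vN: "v s = pushforward M (x s) (x' s)" if s: "s \<in> N" for s
    using has_velocity_in_chart[OF M(2) s within[OF s] xB \<xi> orb(2)[OF NI[OF s]] x'[OF s]]
      v[OF NI[OF s]] has_velocity_unique[OF NI[OF s]] by blast
  have vt: "v t = x' t" using vN[OF tN] pushforward_0[OF M(2) x'B[OF tN]] by (simp add: xt)
  define y where "y = hs_op (x' t)"
  have y: "sym_on M y" using x'B[OF tN] by (simp add: y_def B2s_iff)
  note yD = sym_onD[OF M(2) y] and PD = proj_lagrangian[OF M(2)]
  let ?A = "\<lambda>s. lag_frame M (hs_op (x s))" and ?B = "\<lambda>s. lag_coframe M (hs_op (x s))"
    and ?S = "\<lambda>s. resolvent (hs_op (x s))"
  have dS: "(?S has_vector_derivative 0) (at t within N)" "?S t = id_blinfun"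
    using resolvent_has_vector_derivative_0[OF M(2) tN _ xt x'[OF tN]] xB by blast+
  note dAB = frame_has_vector_derivative[OF x'[OF tN], of M, folded y_def]
  have dy: "((\<lambda>s. hs_op (x' s)) has_vector_derivative 0) (at t within N)"
    using hs_op_has_vector_derivative[OF x''[OF tN]] by (simp add: x''t hs_op_simps)
  have ABt: "?A t = proj M" "?B t = proj M"
    by (simp_all add: lag_frame_def lag_coframe_def xt hs_op_simps)
  note comp = blinfun_compose_has_vector_derivative
  have "((\<lambda>s. ?A s o\<^sub>L ?S s o\<^sub>L hs_op (x' s) o\<^sub>L (?S s o\<^sub>L ?B s)) has_vector_derivative
      (y o\<^sub>L y o\<^sub>L J) - (J o\<^sub>L y o\<^sub>L y)) (at t within N)"
    by (rule has_vector_derivative_eq_rhs[OF comp[OF comp[OF comp[OF dAB(1) dS(1)] dy] comp[OF dS(1) dAB(2)]]])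
      (rule blinfun_eqI, simp add: ABt dS(2) blinfun.bilinear_simps yD PD flip: y_def)
  then have "((\<lambda>s. hs_op (v s)) has_vector_derivative (y o\<^sub>L y o\<^sub>L J) - (J o\<^sub>L y o\<^sub>L y)) (at t within N)"
    by (rule has_vector_derivative_transform[OF tN, rotated]) (simp add: vN pushforward_def)
  from has_vector_derivative_add[OF const_compose_has_vector_derivative(1)[OF this, of J]
      const_compose_has_vector_derivative(2)[OF this, of J]]
  have "((\<lambda>s. momentum (v s)) has_vector_derivative
      (J o\<^sub>L ((y o\<^sub>L y o\<^sub>L J) - (J o\<^sub>L y o\<^sub>L y))) + (((y o\<^sub>L y o\<^sub>L J) - (J o\<^sub>L y o\<^sub>L y)) o\<^sub>L J)) (at t within N)"
    unfolding momentum_def .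
  moreover have "(J o\<^sub>L ((y o\<^sub>L y o\<^sub>L J) - (J o\<^sub>L y o\<^sub>L y))) + (((y o\<^sub>L y o\<^sub>L J) - (J o\<^sub>L y o\<^sub>L y)) o\<^sub>L J) = 0"
    by (rule blinfun_eqI) (simp add: blinfun.bilinear_simps)
  ultimately show "((\<lambda>s. momentum (v s)) has_vector_derivative 0) (at t within {0..1})"
    using within[OF tN] by simp
  have "((\<lambda>s. ?A s o\<^sub>L (?S s o\<^sub>L ?B s)) has_vector_derivative
      ((proj M o\<^sub>L momentum (v t)) - (momentum (v t) o\<^sub>L proj M))) (at t within N)"
  proof (rule has_vector_derivative_eq_rhs[OF comp[OF dAB(1) comp[OF dS(1) dAB(2)]]], rule blinfun_eqI)
    fix u
    have "y (J (proj M u)) = 0" "proj M (J (y u)) = 0"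
      using sym_on_J_proj[OF M(2) y] PD(1) yD(4) by auto
    then show "((?A t o\<^sub>L ((?S t o\<^sub>L (y o\<^sub>L J)) + (0 o\<^sub>L ?B t))) + (- (J o\<^sub>L y) o\<^sub>L (?S t o\<^sub>L ?B t))) u
        = ((proj M o\<^sub>L momentum (v t)) - (momentum (v t) o\<^sub>L proj M)) u"
      by (simp add: ABt dS(2) momentum_def vt blinfun.bilinear_simps yD PD flip: y_def)
  qed
  then have "((\<lambda>s. proj (\<xi> s)) has_vector_derivative
      ((proj M o\<^sub>L momentum (v t)) - (momentum (v t) o\<^sub>L proj M))) (at t within N)"
  proof (rule has_vector_derivative_transform[OF tN, rotated])
    fix s assume s: "s \<in> N"
    show "proj (\<xi> s) = ?A s o\<^sub>L (?S s o\<^sub>L ?B s)"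
      using proj_lag_graph[OF M(2) xB[OF s, unfolded B2s_iff]] orb(2)[OF NI[OF s]] \<xi>[OF s]
      by (intro blinfun_eqI) simp
  qed
  then show "((\<lambda>s. proj (\<xi> s)) has_vector_derivative
       ((proj (\<xi> t) o\<^sub>L momentum (v t)) - (momentum (v t) o\<^sub>L proj (\<xi> t)))) (at t within {0..1})"
    using within[OF tN] by (simp add: M_def)
qed

text \<open>The derivative of \<open>bexp (t Y) (P t) bexp (- t Y)\<close> vanishes.\<close>

lemma commutator_flow:
  assumes P: "\<And>t. t \<in> {0..1} \<Longrightarrow>
      (P has_vector_derivative ((P t o\<^sub>L Y) - (Y o\<^sub>L P t))) (at t within {0..1})"
    and t: "t \<in> {0..1::real}"
  shows "P t = bexp ((- t) *\<^sub>R Y) o\<^sub>L P 0 o\<^sub>L bexp (t *\<^sub>R Y)"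
proof -
  let ?E = "\<lambda>t. bexp (t *\<^sub>R Y)" and ?F = "\<lambda>t. bexp ((- t) *\<^sub>R Y)"
  have inv: "?E t o\<^sub>L ?F t = id_blinfun" "?F t o\<^sub>L ?E t = id_blinfun" for t
    using bexp_add[of t Y "- t"] bexp_add[of "- t" Y t] by (simp_all add: bexp_0)
  have "((\<lambda>t. ?E t o\<^sub>L P t o\<^sub>L ?F t) has_vector_derivative 0) (at t within {0..1})" if "t \<in> {0..1}" for t
    by (rule has_vector_derivative_eq_rhs[OF blinfun_compose_has_vector_derivative[OF
          blinfun_compose_has_vector_derivative[OF has_vector_derivative_at_within[OF bexp_has_vector_derivative] P[OF that]]
          bexp_minus_has_vector_derivative]])
      (rule blinfun_eqI, simp add: blinfun.bilinear_simps bexp_commute)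
  from has_vector_derivative_zero_unique[OF convex_real_interval(5) this t, of 0]
  have "?E t o\<^sub>L P t o\<^sub>L ?F t = ?E 0 o\<^sub>L P 0 o\<^sub>L ?F 0" by simp
  also have "\<dots> = P 0" by (rule blinfun_eqI) (simp add: bexp_0)
  finally have c: "?E t o\<^sub>L P t o\<^sub>L ?F t = P 0" .
  have "P t = (?F t o\<^sub>L ?E t) o\<^sub>L P t o\<^sub>L (?F t o\<^sub>L ?E t)"
    unfolding inv by (rule blinfun_eqI) simp
  also have "\<dots> = ?F t o\<^sub>L (?E t o\<^sub>L P t o\<^sub>L ?F t) o\<^sub>L ?E t" by (rule blinfun_eqI) simp
  finally show ?thesis unfolding c .
qed

lemma geodesic_eq_exp:
  assumes L0: "L0 \<in> lagrangian J" and lc: "levi_civita J L0 \<Gamma>" and geo: "geodesic J L0 \<Gamma> \<xi>"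
    and w: "has_velocity J \<xi> 0 w" and t: "t \<in> {0..1}"
  shows "\<xi> t = bexp ((- t) *\<^sub>R momentum w) ` \<xi> 0"
proof -
  have orb: "\<xi> s \<in> orbit J L0" "\<xi> s \<in> lagrangian J" if "s \<in> {0..1}" for s
    using geo that orbit_lagrangian[OF L0] unfolding geodesic_def by blast+
  have "\<exists>v. has_velocity J \<xi> s v" if s: "s \<in> {0..1}" for s
    using geo orb(1)[OF s] s chart_dom_self[OF L0 orb(1)[OF s]]
    unfolding geodesic_def has_velocity_def by blast
  then obtain v where v: "\<And>s. s \<in> {0..1} \<Longrightarrow> has_velocity J \<xi> s (v s)" by metis
  note loc = geodesic_momentum_and_projection[OF L0 lc geo v]
  have "v 0 = w" using has_velocity_unique[OF _ v w] by simp
  then have mom: "momentum (v s) = momentum w" if "s \<in> {0..1}" for s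
    using has_vector_derivative_zero_unique[OF convex_real_interval(5) loc(1) that, of 0] by simp
  have P: "proj (\<xi> t) = bexp ((- t) *\<^sub>R momentum w) o\<^sub>L proj (\<xi> 0) o\<^sub>L bexp (t *\<^sub>R momentum w)"
    using loc(2) mom by (intro commutator_flow t) simp
  have "bexp (t *\<^sub>R momentum w) o\<^sub>L bexp ((- t) *\<^sub>R momentum w) = id_blinfun"
    by (simp only: bexp_add) (simp add: bexp_0)
  from arg_cong[OF this, of blinfun_apply]
  have "bexp (t *\<^sub>R momentum w) (bexp ((- t) *\<^sub>R momentum w) u) = u" for u
    by (simp add: fun_eq_iff)
  then have surj: "range (bexp (t *\<^sub>R momentum w)) = UNIV" by (metis surjI)
  have "\<xi> t = range (proj (\<xi> t))" using lagrangianD[OF orb(2)[OF t]] by (simp add: proj_range)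
  also have "\<dots> = bexp ((- t) *\<^sub>R momentum w) ` proj (\<xi> 0) ` range (bexp (t *\<^sub>R momentum w))"
    unfolding P by (simp add: image_image)
  also have "proj (\<xi> 0) ` range (bexp (t *\<^sub>R momentum w)) = \<xi> 0"
    unfolding surj using lagrangianD[OF orb(2)[of 0]] by (simp add: proj_range)
  finally show ?thesis .
qed

lemma momentum_properties:
  assumes M: "M \<in> lagrangian J" and w: "w \<in> B2s M"
  shows "momentum w \<in> sp2 J" "adj (momentum w) = - momentum w" "d1_pi J M (momentum w) = - hs_op w"
proof -
  have aw: "adj (hs_op w) = hs_op w" using w by (simp add: B2s_def)
  have wM: "sym_on M (hs_op w)" using w by (simp add: B2s_iff)
  have "adj (momentum w) u = (- momentum w) u" for u
    by (simp add: momentum_def aw J_adj blinfun.bilinear_simps)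
  then show skew: "adj (momentum w) = - momentum w" by (rule blinfun_eqI)
  have "hilbert_schmidt (momentum w)"
    unfolding momentum_def
    by (intro hilbert_schmidt_add hs_compose_left hs_compose_right hilbert_schmidt_hs_op)
  moreover have "momentum w o\<^sub>L J = - (J o\<^sub>L adj (momentum w))"
    unfolding skew by (rule blinfun_eqI) (simp add: momentum_def blinfun.bilinear_simps)
  ultimately show "momentum w \<in> sp2 J" by (simp add: sp2_def)
  show "d1_pi J M (momentum w) = - hs_op w"
  proof (rule blinfun_eqI)
    fix u
    have "hs_op w (J (proj M u)) = 0"
      by (rule sym_on_J_proj(1)[OF M wM proj_lagrangian(1)[OF M]])
    then show "d1_pi J M (momentum w) u = (- hs_op w) u"
      by (simp add: d1_pi_def momentum_def blinfun.bilinear_simps sym_onD[OF M wM])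
  qed
qed

end

theorem theorem4p6:
  fixes J :: "'a::{real_inner,banach} \<Rightarrow>\<^sub>L 'a"
    and L0 L :: "'a set"
    and \<Gamma> :: "'a set \<Rightarrow> 'a hs \<Rightarrow> 'a hs \<Rightarrow> 'a hs \<Rightarrow> 'a hs"
    and \<xi> :: "real \<Rightarrow> 'a set"
    and w :: "'a hs"
  assumes infinite_dim: "\<not> (\<exists>B::'a set. finite B \<and> span B = UNIV)"
    and J_isometry: "\<forall>x. norm (J x) = norm x"
    and J_square: "J o\<^sub>L J = - id_blinfun"
    and J_adj: "adj J = - J"
    and L0: "L0 \<in> lagrangian J"
    and connection: "levi_civita J L0 \<Gamma>"
    and geodesic: "geodesic J L0 \<Gamma> \<xi>"
    and initial_position: "\<xi> 0 = L"
    and w: "w \<in> B2s L"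
    and initial_velocity: "has_velocity J \<xi> 0 w"
  shows "\<exists>v\<in>sp2 J. d1_pi J L v = - hs_op w \<and>
    (\<forall>t\<in>{0..1}. \<xi> t = (bexp (t *\<^sub>R (adj v - v)) o\<^sub>L bexp (- t *\<^sub>R adj v)) ` L)"
proof -
  interpret complex_structure J by unfold_locales (rule J_square, rule J_adj)
  have "L \<in> orbit J L0" using geodesic initial_position unfolding geodesic_def by auto
  then have L: "L \<in> lagrangian J" by (rule orbit_lagrangian[OF L0])
  note mom = momentum_properties[OF L w]
  show ?thesis
  proof (intro bexI[of _ "momentum w"] conjI ballI mom)
    fix t :: real assume t: "t \<in> {0..1}"
    have "t *\<^sub>R (adj (momentum w) - momentum w) = (- 2 * t) *\<^sub>R momentum w"
      "- t *\<^sub>R adj (momentum w) = t *\<^sub>R momentum w"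
      by (simp_all add: mom algebra_simps scaleR_2 flip: scaleR_scaleR)
    then have "bexp (t *\<^sub>R (adj (momentum w) - momentum w)) o\<^sub>L bexp (- t *\<^sub>R adj (momentum w))
        = bexp ((- t) *\<^sub>R momentum w)"
      using bexp_add[of "- 2 * t" "momentum w" t] by (simp only:) simp
    then show "\<xi> t = (bexp (t *\<^sub>R (adj (momentum w) - momentum w)) o\<^sub>L bexp (- t *\<^sub>R adj (momentum w))) ` L"
      using geodesic_eq_exp[OF L0 connection geodesic initial_velocity t] by (simp add: initial_position)
  qed
qed

end
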